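(* Let $2\le k\le n$ be integers. The Turán graph $T(n,k)$ is determined by its adjacency spectrum; that is, every graph whose adjacency matrix has the same multiset of eigenvalues as that of $T(n,k)$ is isomorphic to $T(n,k)$.
   Context: All graphs are finite, simple and undirected. The Turán graph $T(n,k)$, $2\le k\le n$, is the complete $k$-partite graph on $n$ vertices whose part sizes $n_1,\dots,n_k$ satisfy $|n_i-n_j|\le 1$ for all $i,j$: two vertices are adjacent if and only if they belong to different parts. *)

theory Defs
  imports
    "HOL-Library.Disjoint_Sets"
    "Jordan_Normal_Form.Char_Poly"
    "Graph_Theory.Graph_Theory"
begin

(* A finite simple undirected graph is a pair_graph: a finite digraph without loops whose arc
   relation is symmetric. *)

definition is_turan_graph :: "nat \<Rightarrow> nat \<Rightarrow> 'a pair_pre_digraph \<Rightarrow> bool" where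
  "is_turan_graph n k T \<longleftrightarrow>
     finite (pverts T) \<and> card (pverts T) = n \<and>
     (\<exists>P. partition_on (pverts T) P \<and> card P = k \<and>
          (\<forall>A\<in>P. \<forall>B\<in>P. \<bar>int (card A) - int (card B)\<bar> \<le> 1) \<and>
          parcs T = {(u, v). \<exists>A\<in>P. \<exists>B\<in>P. A \<noteq> B \<and> u \<in> A \<and> v \<in> B})"

lemma is_turan_graph_imp_pair_graph:
  assumes "is_turan_graph n k T"
  shows "pair_graph T"
proof -
  from assms obtain P where fin: "finite (pverts T)" and P: "partition_on (pverts T) P"
    and arcs: "parcs T = {(u, v). \<exists>A\<in>P. \<exists>B\<in>P. A \<noteq> B \<and> u \<in> A \<and> v \<in> B}"
    unfolding is_turan_graph_def by blast
  have sub: "parcs T \<subseteq> pverts T \<times> pverts T"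
    using P unfolding arcs partition_on_def by blast
  have loop: "(u, u) \<notin> parcs T" for u
    using P unfolding arcs partition_on_def disjoint_def by blast
  have sym: "sym (parcs T)"
    unfolding arcs sym_def by blast
  show ?thesis
  proof (unfold_locales)
    show "finite (parcs T)" using sub fin by (meson finite_SigmaI finite_subset)
    show "symmetric (with_proj T)" using sym by (simp add: symmetric_def)
  next
    fix e assume "e \<in> parcs T"
    then show "fst e \<noteq> snd e" using loop by (cases e) auto
  qed (use sub fin in auto)
qed

lemma ex_is_turan_graph:
  assumes "0 < k" "k \<le> n"
  shows "\<exists>T :: nat pair_pre_digraph. is_turan_graph n k T"
proof -
  define C where "C = (\<lambda>r. {i \<in> {..<n}. i mod k = r})"
  define P where "P = C ` {..<k}"
  have memC: "i \<in> C r \<longleftrightarrow> i < n \<and> i mod k = r" for i r by (auto simp: C_def)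
  have inj: "inj_on C {..<k}"
  proof (rule inj_onI)
    fix r s assume "r \<in> {..<k}" "s \<in> {..<k}" "C r = C s"
    then show "r = s" using memC[of r r] memC[of r s] assms by auto
  qed
  have part: "partition_on {..<n} P"
    unfolding partition_on_def
  proof (intro conjI)
    show "\<Union>P = {..<n}" using assms by (auto simp: P_def memC)
    show "disjoint P" by (auto simp: P_def disjoint_def C_def)
    show "{} \<notin> P"
    proof
      assume "{} \<in> P"
      then obtain r where "r < k" "C r = {}" by (auto simp: P_def)
      then show False using memC[of r r] assms by auto
    qed
  qed
  have cardC: "n div k \<le> card (C r) \<and> card (C r) \<le> n div k + 1" if r: "r < k" for r
  proof -
    have inj': "inj_on (\<lambda>q. q * k + r) X" for X using assms by (auto intro: inj_onI)
    have low: "(\<lambda>q. q * k + r) ` {..<n div k} \<subseteq> C r"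
    proof
      fix i assume "i \<in> (\<lambda>q. q * k + r) ` {..<n div k}"
      then obtain q where q: "q < n div k" "i = q * k + r" by auto
      have "i < Suc q * k" using q r by simp
      also have "\<dots> \<le> (n div k) * k" using q by (intro mult_right_mono) auto
      also have "\<dots> \<le> n" by simp
      finally show "i \<in> C r" using q r by (simp add: memC)
    qed
    have up: "C r \<subseteq> (\<lambda>q. q * k + r) ` {..n div k}"
    proof
      fix i assume "i \<in> C r"
      then have "i < n" "i mod k = r" by (simp_all add: memC)
      then have "i = (i div k) * k + r" "i div k \<le> n div k"
        by (auto simp: div_le_mono)
      then show "i \<in> (\<lambda>q. q * k + r) ` {..n div k}" by blast
    qed
    have finC: "finite (C r)" by (simp add: C_def)
    have "n div k \<le> card (C r)"
      using card_mono[OF finC low] card_image[OF inj'[of "{..<n div k}"]] by simp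
    moreover have "card (C r) \<le> n div k + 1"
      using card_mono[OF _ up] card_image[OF inj'[of "{..n div k}"]] by simp
    ultimately show ?thesis by blast
  qed
  have bal: "\<forall>A\<in>P. \<forall>B\<in>P. \<bar>int (card A) - int (card B)\<bar> \<le> 1"
  proof (intro ballI)
    fix A B assume "A \<in> P" "B \<in> P"
    then obtain r s where "r < k" "s < k" "A = C r" "B = C s" by (auto simp: P_def)
    then have "card A \<le> card B + 1" "card B \<le> card A + 1" using cardC[of r] cardC[of s] by auto
    then show "\<bar>int (card A) - int (card B)\<bar> \<le> 1" by linarith
  qed
  have "card P = k" unfolding P_def using card_image[OF inj] by simp
  then have "is_turan_graph n k
      \<lparr>pverts = {..<n}, parcs = {(u, v). \<exists>A\<in>P. \<exists>B\<in>P. A \<noteq> B \<and> u \<in> A \<and> v \<in> B}\<rparr>"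
    unfolding is_turan_graph_def using part bal by (intro conjI exI[of _ P]) auto
  then show ?thesis by blast
qed

definition adjacency_matrix :: "'a pair_pre_digraph \<Rightarrow> 'a list \<Rightarrow> complex mat" where
  "adjacency_matrix G vs =
     mat (length vs) (length vs) (\<lambda>(i, j). if (vs ! i, vs ! j) \<in> parcs G then 1 else 0)"

(* The eigenvalues, with multiplicity, do not depend on the chosen enumeration of the vertices:
   see adjacency_spectrum_eq below. *)
definition adjacency_spectrum :: "'a pair_pre_digraph \<Rightarrow> complex multiset" where
  "adjacency_spectrum G =
     proots (char_poly (adjacency_matrix G (SOME vs. distinct vs \<and> set vs = pverts G)))"

lemma char_poly_adjacency_matrix_reorder:
  assumes "distinct vs" "distinct ws" "set vs = set ws"
  shows "char_poly (adjacency_matrix G vs) = char_poly (adjacency_matrix G ws)"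
proof (rule char_poly_similar)
  define n where "n = length vs"
  have n': "length ws = n"
    using assms distinct_card[of vs] distinct_card[of ws] by (simp add: n_def)
  define P :: "complex mat" where "P = mat n n (\<lambda>(i, j). if vs ! i = ws ! j then 1 else 0)"
  define Q :: "complex mat" where "Q = mat n n (\<lambda>(i, j). if ws ! i = vs ! j then 1 else 0)"
  let ?A = "adjacency_matrix G vs" and ?B = "adjacency_matrix G ws"
  have "\<exists>j<n. ws ! j = vs ! i" if "i < n" for i
    using assms(3) that n' by (metis in_set_conv_nth n_def)
  then obtain s where s: "\<And>i. i < n \<Longrightarrow> s i < n \<and> ws ! s i = vs ! i" by metis
  have "\<exists>j<n. vs ! j = ws ! i" if "i < n" for i
    using assms(3) that n' by (metis in_set_conv_nth n_def)
  then obtain t where t: "\<And>i. i < n \<Longrightarrow> t i < n \<and> vs ! t i = ws ! i" by metis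
  have s': "(vs ! i = ws ! j) = (j = s i)" if "i < n" "j < n" for i j
    using s[OF that(1)] that assms(2) n' by (metis nth_eq_iff_index_eq)
  have t': "(ws ! i = vs ! j) = (j = t i)" if "i < n" "j < n" for i j
    using t[OF that(1)] that assms(1) n_def by (metis nth_eq_iff_index_eq)
  have vv: "(vs ! i = vs ! j) = (i = j)" if "i < n" "j < n" for i j
    using that assms(1) by (simp add: nth_eq_iff_index_eq n_def)
  have ww: "(ws ! i = ws ! j) = (i = j)" if "i < n" "j < n" for i j
    using that assms(2) n' by (simp add: nth_eq_iff_index_eq)
  have carr: "{?A, ?B, P, Q} \<subseteq> carrier_mat n n"
    by (simp add: adjacency_matrix_def P_def Q_def n_def n'[unfolded n_def])
  have PM: "(P * M) $$ (i, j) = M $$ (s i, j)"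
    if "M \<in> carrier_mat n n" "i < n" "j < n" for M i j
  proof -
    have "(P * M) $$ (i, j) = (\<Sum>l = 0..<n. (if vs ! i = ws ! l then 1 else 0) * M $$ (l, j))"
      using that by (simp add: P_def scalar_prod_def)
    also have "\<dots> = (\<Sum>l = 0..<n. if l = s i then M $$ (l, j) else 0)"
      using that by (intro sum.cong) (auto simp: s')
    finally show ?thesis using s[OF that(2)] by simp
  qed
  have QM: "(Q * M) $$ (i, j) = M $$ (t i, j)"
    if "M \<in> carrier_mat n n" "i < n" "j < n" for M i j
  proof -
    have "(Q * M) $$ (i, j) = (\<Sum>l = 0..<n. (if ws ! i = vs ! l then 1 else 0) * M $$ (l, j))"
      using that by (simp add: Q_def scalar_prod_def)
    also have "\<dots> = (\<Sum>l = 0..<n. if l = t i then M $$ (l, j) else 0)"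
      using that by (intro sum.cong) (auto simp: t')
    finally show ?thesis using t[OF that(2)] by simp
  qed
  have MQ: "(M * Q) $$ (i, j) = M $$ (i, s j)"
    if "M \<in> carrier_mat n n" "i < n" "j < n" for M i j
  proof -
    have "(M * Q) $$ (i, j) = (\<Sum>l = 0..<n. M $$ (i, l) * (if ws ! l = vs ! j then 1 else 0))"
      using that by (simp add: Q_def scalar_prod_def)
    also have "\<dots> = (\<Sum>l = 0..<n. if l = s j then M $$ (i, l) else 0)"
      using that by (intro sum.cong) (auto simp: s'[symmetric])
    finally show ?thesis using s[OF that(3)] by simp
  qed
  have PQ: "P * Q = 1\<^sub>m n"
  proof (rule eq_matI)
    fix i j assume "i < dim_row (1\<^sub>m n :: complex mat)" "j < dim_col (1\<^sub>m n :: complex mat)"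
    then show "(P * Q) $$ (i, j) = 1\<^sub>m n $$ (i, j)"
      using PM[of Q i j] carr s[of i] vv[of i j] by (simp add: Q_def)
  qed (use carr in auto)
  have QP: "Q * P = 1\<^sub>m n"
  proof (rule eq_matI)
    fix i j assume "i < dim_row (1\<^sub>m n :: complex mat)" "j < dim_col (1\<^sub>m n :: complex mat)"
    then show "(Q * P) $$ (i, j) = 1\<^sub>m n $$ (i, j)"
      using QM[of P i j] carr t[of i] ww[of i j] by (simp add: P_def)
  qed (use carr in auto)
  have "?A = P * ?B * Q"
  proof (rule eq_matI)
    fix i j assume "i < dim_row (P * ?B * Q)" "j < dim_col (P * ?B * Q)"
    then have ij: "i < n" "j < n" using carr by auto
    have "P * ?B \<in> carrier_mat n n" using carr by auto
    then show "?A $$ (i, j) = (P * ?B * Q) $$ (i, j)"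
      using MQ[of "P * ?B" i j] PM[of ?B i "s j"] carr s ij n'
      by (simp add: adjacency_matrix_def n_def)
  qed (use carr in auto)
  then show "similar_mat ?A ?B" by (rule similar_matI[OF carr PQ QP])
qed

lemma adjacency_spectrum_eq:
  assumes "distinct vs" "set vs = pverts G"
  shows "adjacency_spectrum G = proots (char_poly (adjacency_matrix G vs))"
proof -
  let ?ws = "SOME vs. distinct vs \<and> set vs = pverts G"
  have "distinct ?ws \<and> set ?ws = pverts G"
    by (rule someI[of "\<lambda>vs. distinct vs \<and> set vs = pverts G" vs]) (use assms in simp)
  then show ?thesis
    unfolding adjacency_spectrum_def
    using char_poly_adjacency_matrix_reorder[of ?ws vs G] assms by simp
qed

end

theory Submission
  imports Defs "Jordan_Normal_Form.Schur_Decomposition" "Jordan_Normal_Form.Spectral_Radius"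
begin

text \<open>Hermitian matrices with the same characteristic polynomial are unitarily similar, so for a
  graph G cospectral to T the Hermitian form of the adjacency matrix of G becomes that of T after a
  linear change of variables, and both graphs have equally many vertices and arcs. On T the form
  is the squared modulus of the total sum minus the sum of the squared moduli of the sums over the
  k parts: it is nonpositive on a subspace of codimension 1 and nonnegative on a subspace of
  codimension k - 1.

  Comparing dimensions, the first fact excludes from G an edge together with a non-isolated vertex
  adjacent to neither of its ends, so that G is complete multipartite up to isolated vertices. The
  second bounds cliques of G, hence its number of parts, by k. Among all such graphs with
  at most n vertices only T(n, k) has as many edges as T(n, k).\<close>

subsection \<open>Unitary similarity of Hermitian matrices\<close>

lemma mat_adjoint_index [simp]:
  assumes "i < dim_col A" "j < dim_row A"
  shows "mat_adjoint A $$ (i, j) = conjugate (A $$ (j, i))"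
  using assms unfolding mat_adjoint_def by (simp add: mat_of_rows_index)

lemma mat_adjoint_dim [simp]:
  "dim_row (mat_adjoint A) = dim_col A" "dim_col (mat_adjoint A) = dim_row A"
  unfolding mat_adjoint_def by auto

lemma mat_adjoint_carrier [simp]:
  "A \<in> carrier_mat m n \<Longrightarrow> mat_adjoint A \<in> carrier_mat n m"
  by (auto intro: carrier_matI)

lemma mat_adjoint_mat_adjoint [simp]: "mat_adjoint (mat_adjoint A) = A"
  by (rule eq_matI) auto

lemma mat_adjoint_one [simp]: "mat_adjoint (1\<^sub>m n :: complex mat) = 1\<^sub>m n"
  by (rule eq_matI) auto

lemma mat_adjoint_mult:
  fixes A B :: "complex mat"
  assumes "A \<in> carrier_mat l m" "B \<in> carrier_mat m n"
  shows "mat_adjoint (A * B) = mat_adjoint B * mat_adjoint A"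
  by (rule eq_matI) (use assms in \<open>auto simp: scalar_prod_def mult.commute\<close>)

lemma mat_adjoint_four_block_diag:
  fixes A D :: "complex mat"
  assumes "A \<in> carrier_mat m m" "D \<in> carrier_mat n n"
  shows "mat_adjoint (four_block_mat A (0\<^sub>m m n) (0\<^sub>m n m) D) =
    four_block_mat (mat_adjoint A) (0\<^sub>m m n) (0\<^sub>m n m) (mat_adjoint D)"
  by (rule eq_matI) (use assms in auto)

text \<open>Both products are demanded, so that symmetry and transitivity below reduce to regrouping
  factors.\<close>

definition unitarily_similar :: "nat \<Rightarrow> complex mat \<Rightarrow> complex mat \<Rightarrow> bool" where
  "unitarily_similar n A B \<longleftrightarrow> (\<exists>U \<in> carrier_mat n n.
     mat_adjoint U * U = 1\<^sub>m n \<and> U * mat_adjoint U = 1\<^sub>m n \<and> A = U * B * mat_adjoint U)"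

lemma unitarily_similar_sym:
  assumes "unitarily_similar n A B" "B \<in> carrier_mat n n"
  shows "unitarily_similar n B A"
proof -
  obtain U where U: "U \<in> carrier_mat n n" "mat_adjoint U * U = 1\<^sub>m n" "U * mat_adjoint U = 1\<^sub>m n"
    "A = U * B * mat_adjoint U"
    using assms(1) unfolding unitarily_similar_def by blast
  note c = U(1) mat_adjoint_carrier[OF U(1)] assms(2)
  have "mat_adjoint U * A * U = mat_adjoint U * (U * B * mat_adjoint U) * U" by (simp add: U)
  also have "\<dots> = (mat_adjoint U * U) * B * (mat_adjoint U * U)"
    using c by (simp add: assoc_mult_mat[of _ n n _ n _ n] mult_carrier_mat[of _ n n _ n])
  also have "\<dots> = B" using U c by simp
  finally have "B = mat_adjoint U * A * mat_adjoint (mat_adjoint U)" by simp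
  then show ?thesis unfolding unitarily_similar_def using U c
    by (intro bexI[of _ "mat_adjoint U"]) auto
qed

lemma unitarily_similar_trans:
  assumes "unitarily_similar n A B" "unitarily_similar n B C" "C \<in> carrier_mat n n"
  shows "unitarily_similar n A C"
proof -
  obtain U where U: "U \<in> carrier_mat n n" "mat_adjoint U * U = 1\<^sub>m n" "U * mat_adjoint U = 1\<^sub>m n"
    "A = U * B * mat_adjoint U"
    using assms(1) unfolding unitarily_similar_def by blast
  obtain V where V: "V \<in> carrier_mat n n" "mat_adjoint V * V = 1\<^sub>m n" "V * mat_adjoint V = 1\<^sub>m n"
    "B = V * C * mat_adjoint V"
    using assms(2) unfolding unitarily_similar_def by blast
  note c = U(1) V(1) mat_adjoint_carrier[OF U(1)] mat_adjoint_carrier[OF V(1)] assms(3)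
  note ass = assoc_mult_mat[of _ n n _ n _ n] mult_carrier_mat[of _ n n _ n]
  have adj: "mat_adjoint (U * V) = mat_adjoint V * mat_adjoint U"
    using c mat_adjoint_mult by blast
  have "mat_adjoint (U * V) * (U * V) = mat_adjoint V * ((mat_adjoint U * U) * V)"
    using c adj by (simp add: ass)
  also have "\<dots> = 1\<^sub>m n" using U V c by simp
  finally have 1: "mat_adjoint (U * V) * (U * V) = 1\<^sub>m n" .
  have "(U * V) * mat_adjoint (U * V) = U * ((V * mat_adjoint V) * mat_adjoint U)"
    using c adj by (simp add: ass)
  also have "\<dots> = 1\<^sub>m n" using U V c by simp
  finally have 2: "(U * V) * mat_adjoint (U * V) = 1\<^sub>m n" .
  have "A = (U * V) * C * mat_adjoint (U * V)"
    using U(4) V(4) c adj by (simp add: ass)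
  with 1 2 c show ?thesis unfolding unitarily_similar_def
    by (intro bexI[of _ "U * V"]) auto
qed

lemma unitarily_similar_imp_similar:
  assumes "unitarily_similar n A B" "B \<in> carrier_mat n n"
  shows "similar_mat A B"
proof -
  obtain U where U: "U \<in> carrier_mat n n" "mat_adjoint U * U = 1\<^sub>m n" "U * mat_adjoint U = 1\<^sub>m n"
    "A = U * B * mat_adjoint U"
    using assms(1) unfolding unitarily_similar_def by blast
  have "{A, B, U, mat_adjoint U} \<subseteq> carrier_mat n n"
    using U assms(2) by (simp add: mult_carrier_mat[of _ n n _ n])
  then show ?thesis using similar_matI U by blast
qed

lemma unitarily_similar_four_block:
  assumes "unitarily_similar n B C" "C \<in> carrier_mat n n" "A \<in> carrier_mat m m"
  shows "unitarily_similar (m + n) (four_block_mat A (0\<^sub>m m n) (0\<^sub>m n m) B)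
           (four_block_mat A (0\<^sub>m m n) (0\<^sub>m n m) C)"
proof -
  obtain U where U: "U \<in> carrier_mat n n" "mat_adjoint U * U = 1\<^sub>m n" "U * mat_adjoint U = 1\<^sub>m n"
    "B = U * C * mat_adjoint U"
    using assms(1) unfolding unitarily_similar_def by blast
  have U': "mat_adjoint U \<in> carrier_mat n n" using U by simp
  let ?b = "\<lambda>X Y. four_block_mat X (0\<^sub>m m n) (0\<^sub>m n m) Y :: complex mat"
  have mult: "?b X Y * ?b X' Y' = ?b (X * X') (Y * Y')"
    if "X \<in> carrier_mat m m" "X' \<in> carrier_mat m m" "Y \<in> carrier_mat n n" "Y' \<in> carrier_mat n n"
    for X X' Y Y'
    using that by (subst mult_four_block_mat[where ?nr1.0 = m and ?n1.0 = m and ?n2.0 = n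
          and ?nr2.0 = n and ?nc1.0 = m and ?nc2.0 = n]) auto
  have one: "?b (1\<^sub>m m) (1\<^sub>m n) = 1\<^sub>m (m + n)" by (rule eq_matI) auto
  have adj: "mat_adjoint (?b (1\<^sub>m m) U) = ?b (1\<^sub>m m) (mat_adjoint U)"
    using U by (simp add: mat_adjoint_four_block_diag)
  show ?thesis unfolding unitarily_similar_def
  proof (intro bexI[of _ "?b (1\<^sub>m m) U"] conjI)
    show "mat_adjoint (?b (1\<^sub>m m) U) * ?b (1\<^sub>m m) U = 1\<^sub>m (m + n)"
      "?b (1\<^sub>m m) U * mat_adjoint (?b (1\<^sub>m m) U) = 1\<^sub>m (m + n)"
      unfolding adj using U U' by (simp_all add: mult one)
    have "?b (1\<^sub>m m) U * ?b A C = ?b A (U * C)" using U assms by (simp add: mult)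
    moreover have "?b A (U * C) * ?b (1\<^sub>m m) (mat_adjoint U) = ?b A B"
      using U U' assms(2,3) by (subst mult) (auto simp: U(4))
    ultimately show "?b A B = ?b (1\<^sub>m m) U * ?b A C * mat_adjoint (?b (1\<^sub>m m) U)"
      by (simp add: adj)
  qed (use U in auto)
qed

text \<open>Extend \<open>v\<close> to a basis with \<open>v\<close> in front, orthogonalise it by
  Gram-Schmidt, which keeps the first vector, and divide each vector by its norm. The scalar
  \<open>c\<close> is the reciprocal of the norm of \<open>v\<close>.\<close>

lemma unitary_completion:
  fixes v :: "complex vec"
  assumes v: "v \<in> carrier_vec n" and v0: "v \<noteq> 0\<^sub>v n"
  obtains W c where "W \<in> carrier_mat n n" "mat_adjoint W * W = 1\<^sub>m n" "col W 0 = c \<cdot>\<^sub>v v"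
proof -
  have n: "n > 0" using v v0 by (metis carrier_vecD gr0I vec_of_dim_0)
  interpret cof_vec_space n "TYPE(complex)" .
  define b where "b = basis_completion v"
  define ws where "ws = gram_schmidt n b"
  from basis_completion[OF v v0, folded b_def]
  have dist_b: "distinct b"
    and indep: "\<not> lin_dep (set b)" and b: "set b \<subseteq> carrier_vec n" and hdb: "hd b = v"
    and len_b: "length b = n" by auto
  from hdb len_b n obtain vs where bv: "b = v # vs" by (cases b, auto)
  from gram_schmidt_result[OF b dist_b indep refl, folded ws_def]
  have ws: "set ws \<subseteq> carrier_vec n" "corthogonal ws" "length ws = n"
    by (auto simp: len_b)
  from gram_schmidt_hd[OF v, of vs, folded bv] have hdws: "hd ws = v" unfolding ws_def .
  have ws0: "ws ! 0 = v" using hdws ws(3) n by (metis hd_conv_nth list.size(3) less_irrefl)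
  have wi: "ws ! i \<in> carrier_vec n" if "i < n" for i using ws that by auto
  \<comment> \<open>The Gram-Schmidt vectors are orthogonal but not normalised; \<open>r i\<close>
    is the norm of the i-th one.\<close>
  define r where "r i = sqrt (\<Sum>j<n. (cmod (ws ! i $ j))\<^sup>2)" for i
  have ip: "(\<Sum>l<n. ws ! i $ l * cnj (ws ! j $ l)) = (if i = j then (complex_of_real (r i))\<^sup>2 else 0)"
    if "i < n" "j < n" for i j
  proof -
    have e: "ws ! i \<bullet>c ws ! j = (\<Sum>l<n. ws ! i $ l * cnj (ws ! j $ l))"
      using wi[OF that(1)] wi[OF that(2)] by (simp add: scalar_prod_def lessThan_atLeast0)
    show ?thesis
    proof (cases "i = j")
      case True
      have "0 \<le> (\<Sum>j<n. (cmod (ws ! i $ j))\<^sup>2)" by (intro sum_nonneg) auto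
      then show ?thesis using True
        by (simp add: r_def complex_norm_square[symmetric] flip: of_real_power)
    next
      case False
      then show ?thesis using e corthogonalD[OF ws(2), of i j] that ws(3) by simp
    qed
  qed
  have r0: "r i \<noteq> 0" if "i < n" for i
  proof -
    have "ws ! i \<bullet>c ws ! i \<noteq> 0" using corthogonalD[OF ws(2), of i i] that ws(3) by simp
    moreover have "ws ! i \<bullet>c ws ! i = (\<Sum>l<n. ws ! i $ l * cnj (ws ! i $ l))"
      using wi[OF that] by (simp add: scalar_prod_def lessThan_atLeast0)
    ultimately show ?thesis using ip[OF that that] by auto
  qed
  define W where "W = mat n n (\<lambda>(i, j). ws ! j $ i / complex_of_real (r j))"
  show ?thesis
  proof (rule that)
    show "W \<in> carrier_mat n n" by (simp add: W_def)
    show "mat_adjoint W * W = 1\<^sub>m n"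
    proof (rule eq_matI)
      fix i j assume "i < dim_row (1\<^sub>m n :: complex mat)" "j < dim_col (1\<^sub>m n :: complex mat)"
      then have ij: "i < n" "j < n" by auto
      have "(mat_adjoint W * W) $$ (i, j) =
        (\<Sum>l<n. ws ! j $ l * cnj (ws ! i $ l) / (complex_of_real (r i) * complex_of_real (r j)))"
        using ij by (auto simp: W_def scalar_prod_def lessThan_atLeast0 intro!: sum.cong)
      also have "\<dots> = (\<Sum>l<n. ws ! j $ l * cnj (ws ! i $ l)) / (complex_of_real (r i) * complex_of_real (r j))"
        by (simp add: sum_divide_distrib)
      also have "\<dots> = 1\<^sub>m n $$ (i, j)"
        using ij ip[of j i] r0[of i] by (auto simp: power2_eq_square)
      finally show "(mat_adjoint W * W) $$ (i, j) = 1\<^sub>m n $$ (i, j)" .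
    qed (auto simp: W_def)
    show "col W 0 = (1 / complex_of_real (r 0)) \<cdot>\<^sub>v v"
      by (rule eq_vecI) (use n v ws0 in \<open>auto simp: W_def\<close>)
  qed
qed

text \<open>One step of the spectral theorem: conjugate by a unitary \<open>W\<close> whose first
  column is a multiple of an eigenvector. The first column of the result is \<open>e\<close> times
  the first unit vector, and hermiticity carries its zeros over to the first row.\<close>

lemma hermitian_deflation:
  assumes A: "A \<in> carrier_mat (Suc n) (Suc n)" and herm: "mat_adjoint A = A"
    and ev: "eigenvalue A e"
  obtains D where "D \<in> carrier_mat n n" "mat_adjoint D = D"
    "unitarily_similar (Suc n) A (four_block_mat (mat 1 1 (\<lambda>_. e)) (0\<^sub>m 1 n) (0\<^sub>m n 1) D)"
proof -
  let ?n = "Suc n"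
  obtain v where v: "v \<in> carrier_vec ?n" "v \<noteq> 0\<^sub>v ?n" "A *\<^sub>v v = e \<cdot>\<^sub>v v"
    using ev A unfolding eigenvalue_def eigenvector_def by auto
  obtain W c where W: "W \<in> carrier_mat ?n ?n" "mat_adjoint W * W = 1\<^sub>m ?n" "col W 0 = c \<cdot>\<^sub>v v"
    using unitary_completion[OF v(1,2)] by blast
  have W': "mat_adjoint W \<in> carrier_mat ?n ?n" using W by simp
  have WW: "W * mat_adjoint W = 1\<^sub>m ?n" using mat_mult_left_right_inverse[OF W' W(1) W(2)] .
  define B where "B = mat_adjoint W * A * W"
  note ass = assoc_mult_mat[of _ ?n ?n _ ?n _ ?n] mult_carrier_mat[of _ ?n ?n _ ?n]
  have B: "B \<in> carrier_mat ?n ?n" using W W' A by (simp add: B_def ass)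
  have hB: "mat_adjoint B = B"
    unfolding B_def using W W' A herm by (simp add: mat_adjoint_mult[of _ ?n ?n _ ?n] ass)
  have us: "unitarily_similar ?n B A"
    unfolding unitarily_similar_def B_def using W W' WW by (intro bexI[of _ "mat_adjoint W"]) auto
  have AW: "col (A * W) 0 = e \<cdot>\<^sub>v col W 0"
  proof -
    have "col (A * W) 0 = A *\<^sub>v (c \<cdot>\<^sub>v v)" using col_mult2[OF A W(1)] W(3) by simp
    also have "\<dots> = c \<cdot>\<^sub>v (e \<cdot>\<^sub>v v)" using mult_mat_vec[OF A v(1)] v(3) by simp
    also have "\<dots> = e \<cdot>\<^sub>v col W 0" unfolding W(3) by (simp add: smult_smult_assoc mult.commute)
    finally show ?thesis .
  qed
  \<comment> \<open>Since \<open>A\<close> multiplies the first column of \<open>W\<close> by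
    \<open>e\<close>, this entry is \<open>e\<close> times entry \<open>(i, 0)\<close> of
    \<open>mat_adjoint W * W\<close>, which is the identity.\<close>
  have B0: "B $$ (i, 0) = (if i = 0 then e else 0)" if "i < ?n" for i
  proof -
    have "B $$ (i, 0) = (mat_adjoint W * (A * W)) $$ (i, 0)" using W W' A by (simp add: B_def ass)
    also have "\<dots> = row (mat_adjoint W) i \<bullet> (e \<cdot>\<^sub>v col W 0)"
      using W W' A that AW by (subst index_mult_mat) auto
    also have "\<dots> = e * (row (mat_adjoint W) i \<bullet> col W 0)"
      using v(1) W W' that by (intro scalar_prod_smult_distrib[of _ ?n]) auto
    also have "row (mat_adjoint W) i \<bullet> col W 0 = (mat_adjoint W * W) $$ (i, 0)"
      using W W' that by (subst index_mult_mat) auto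
    also have "\<dots> = (if i = 0 then 1 else 0)" using that by (simp add: W)
    finally show ?thesis by simp
  qed
  have Bh: "B $$ (i, j) = cnj (B $$ (j, i))" if "i < ?n" "j < ?n" for i j
    using mat_adjoint_index[of i B j] that B by (auto simp: hB)
  define D where "D = mat n n (\<lambda>(i, j). B $$ (Suc i, Suc j))"
  have BD: "B = four_block_mat (mat 1 1 (\<lambda>_. e)) (0\<^sub>m 1 n) (0\<^sub>m n 1) D"
  proof (rule eq_matI, goal_cases)
    case (1 i j)
    then have "i < ?n" "j < ?n" by (auto simp: D_def)
    then show ?case using B0[of i] B0[of j] Bh[of i j]
      by (cases i; cases j) (auto simp: D_def)
  qed (use B in \<open>auto simp: D_def\<close>)
  show ?thesis
  proof (rule that[of D])
    show "D \<in> carrier_mat n n" by (simp add: D_def)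
    show "mat_adjoint D = D" by (rule eq_matI) (simp_all add: D_def Bh[symmetric])
    show "unitarily_similar ?n A (four_block_mat (mat 1 1 (\<lambda>_. e)) (0\<^sub>m 1 n) (0\<^sub>m n 1) D)"
      using unitarily_similar_sym[OF us A] BD by simp
  qed
qed

text \<open>Induction on the dimension: a common eigenvalue is split off from both matrices, its
  linear factor is cancelled from the characteristic polynomials, and the remaining Hermitian blocks
  are compared by the induction hypothesis.\<close>

theorem hermitian_cospectral_unitarily_similar:
  assumes "A \<in> carrier_mat n n" "B \<in> carrier_mat n n" "mat_adjoint A = A" "mat_adjoint B = B"
    and "char_poly A = char_poly B"
  shows "unitarily_similar n A B"
  using assms
proof (induction n arbitrary: A B)
  case 0
  then show ?case unfolding unitarily_similar_def
    by (intro bexI[of _ "1\<^sub>m 0"]) (auto intro: eq_matI)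
next
  case (Suc n)
  obtain e where e: "eigenvalue A e"
    using spectrum_non_empty[OF Suc.prems(1)] unfolding spectrum_def by auto
  then have e': "eigenvalue B e"
    using Suc.prems by (simp add: eigenvalue_root_char_poly)
  let ?e = "mat 1 1 (\<lambda>_. e)"
  let ?b = "\<lambda>X. four_block_mat ?e (0\<^sub>m 1 n) (0\<^sub>m n 1) X"
  obtain D where D: "D \<in> carrier_mat n n" "mat_adjoint D = D" "unitarily_similar (Suc n) A (?b D)"
    using hermitian_deflation[OF Suc.prems(1,3) e] .
  obtain E where E: "E \<in> carrier_mat n n" "mat_adjoint E = E" "unitarily_similar (Suc n) B (?b E)"
    using hermitian_deflation[OF Suc.prems(2,4) e'] .
  have c: "?b D \<in> carrier_mat (Suc n) (Suc n)" "?b E \<in> carrier_mat (Suc n) (Suc n)"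
    using D E four_block_carrier_mat[of ?e 1 1 D n n] four_block_carrier_mat[of ?e 1 1 E n n] by auto
  have cp: "char_poly (?b X) = char_poly ?e * char_poly X" if "X \<in> carrier_mat n n" for X
    using that by (intro char_poly_four_block_zeros_col) auto
  have "char_poly (?b D) = char_poly (?b E)"
    using Suc.prems(5) char_poly_similar[OF unitarily_similar_imp_similar[OF D(3) c(1)]]
      char_poly_similar[OF unitarily_similar_imp_similar[OF E(3) c(2)]] by simp
  moreover have "char_poly ?e \<noteq> 0"
    using degree_monic_char_poly[of ?e 1] by auto
  ultimately have "char_poly D = char_poly E" using cp D E by simp
  then have "unitarily_similar n D E" using Suc.IH D E by blast
  then have "unitarily_similar (Suc n) (?b D) (?b E)"
    using unitarily_similar_four_block[of n D E ?e 1] E by simp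
  then show ?case
    using unitarily_similar_trans D(3) unitarily_similar_sym[OF E(3) c(2)] c Suc.prems(2) by blast
qed

section \<open>Homogeneous linear systems with fewer equations than unknowns\<close>

text \<open>Gaussian elimination, one equation at a time. This is the only dimension count used
  later: the linear conditions to be imposed are collected in \<open>F\<close>, and \<open>x\<close>
  vanishes outside \<open>R\<close> so that it can serve as a function on all vertices supported on
  \<open>R\<close>.\<close>

lemma underdetermined_system:
  fixes F :: "('b \<Rightarrow> 'f::field) set"
  assumes "finite F" "finite R" "card F < card R"
  obtains x where "\<exists>r\<in>R. x r \<noteq> 0" "\<And>r. r \<notin> R \<Longrightarrow> x r = 0" "\<And>g. g \<in> F \<Longrightarrow> (\<Sum>r\<in>R. g r * x r) = 0"
proof -
  \<comment> \<open>The equations are indexed by \<open>J\<close> instead of forming a set, because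
    elimination may make distinct equations equal while the count must stay under control.\<close>
  have "\<exists>x. (\<exists>r\<in>R. x r \<noteq> 0) \<and> (\<forall>j\<in>J. (\<Sum>r\<in>R. M j r * x r) = 0)"
    if "finite J" "finite R" "card J < card R" for J :: "'j set" and R :: "'b set" and M :: "'j \<Rightarrow> 'b \<Rightarrow> 'f"
    using that
  proof (induction J arbitrary: R M rule: finite_induct)
    case empty
    then have "R \<noteq> {}" by auto
    then show ?case by (intro exI[of _ "\<lambda>_. 1"]) auto
  next
    case (insert j J)
    show ?case
    proof (cases "\<forall>r\<in>R. M j r = 0")
      case True
      have "card J < card R" using insert by simp
      from insert.IH[OF insert.prems(1) this, of M] True show ?thesis by auto
    next
      case False
      then obtain s where s: "s \<in> R" "M j s \<noteq> 0" by blast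
      let ?R = "R - {s}"
      \<comment> \<open>Equation \<open>i\<close> after elimination of the unknown \<open>s\<close>
        with the pivot \<open>M j s\<close>.\<close>
      define N where "N i r = M i r - M i s * M j r / M j s" for i r
      have "card J < card ?R" using insert s by simp
      from insert.IH[OF _ this, of N] insert.prems(1) obtain x
        where x: "\<exists>r\<in>?R. x r \<noteq> 0" "\<forall>i\<in>J. (\<Sum>r\<in>?R. N i r * x r) = 0" by auto
      \<comment> \<open>The value of the unknown \<open>s\<close> that equation \<open>j\<close>
        dictates once the other unknowns are given by \<open>x\<close>.\<close>
      define a where "a = - (\<Sum>r\<in>?R. M j r * x r) / M j s"
      define y where "y = x(s := a)"
      have split: "(\<Sum>r\<in>R. M i r * y r) = M i s * a + (\<Sum>r\<in>?R. M i r * x r)" for i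
        using s insert.prems(1) by (simp add: sum.remove[of R s] y_def)
      have "(\<Sum>r\<in>R. M i r * y r) = 0" if "i \<in> J" for i
      proof -
        have "0 = (\<Sum>r\<in>?R. N i r * x r)" using x that by simp
        also have "\<dots> = (\<Sum>r\<in>?R. M i r * x r) - (\<Sum>r\<in>?R. M i s / M j s * (M j r * x r))"
          by (simp add: N_def sum_subtractf[symmetric] algebra_simps)
        also have "\<dots> = (\<Sum>r\<in>R. M i r * y r)"
          unfolding split a_def by (simp add: sum_distrib_left[symmetric] sum_divide_distrib[symmetric])
        finally show ?thesis by simp
      qed
      moreover have "(\<Sum>r\<in>R. M j r * y r) = 0" using s by (simp add: split a_def)
      moreover have "\<exists>r\<in>R. y r \<noteq> 0" using x(1) by (auto simp: y_def)
      ultimately show ?thesis by blast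
    qed
  qed
  from this[OF assms, of "\<lambda>g. g"] obtain x where x: "\<exists>r\<in>R. x r \<noteq> 0" "\<forall>g\<in>F. (\<Sum>r\<in>R. g r * x r) = 0"
    by blast
  show ?thesis by (rule that[of "\<lambda>r. if r \<in> R then x r else 0"]) (use x in auto)
qed

subsection \<open>The Hermitian form of a graph\<close>

text \<open>The Hermitian form of the adjacency matrix, summed over vertices rather than list
  positions so that enumerations stay out of the combinatorial arguments.\<close>

definition quad_form :: "'a pair_pre_digraph \<Rightarrow> ('a \<Rightarrow> complex) \<Rightarrow> complex" where
  "quad_form G f = (\<Sum>u\<in>pverts G. \<Sum>v\<in>pverts G. if (u, v) \<in> parcs G then cnj (f u) * f v else 0)"

lemma proots_eq_imp_eq:
  fixes p q :: "complex poly"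
  assumes "monic p" "monic q" "proots p = proots q"
  shows "p = q"
  using complex_poly_decompose_multiset[of p] complex_poly_decompose_multiset[of q] assms by simp

lemma mat_adjoint_adjacency_matrix:
  assumes "sym (parcs G)"
  shows "mat_adjoint (adjacency_matrix G vs) = adjacency_matrix G vs"
  by (rule eq_matI) (use assms in \<open>auto simp: adjacency_matrix_def dest: symD\<close>)

text \<open>Characteristic polynomials are monic and split over the complex numbers, so equal
  spectra make them equal; their degrees then give equally many vertices, and the theorem on
  Hermitian matrices applies to any chosen enumerations.\<close>

lemma cospectral_imp_unitarily_similar:
  assumes G: "finite (pverts G)" "sym (parcs G)" and H: "finite (pverts H)" "sym (parcs H)"
    and spec: "adjacency_spectrum G = adjacency_spectrum H"
  obtains vs ws where "distinct vs" "set vs = pverts G" "distinct ws" "set ws = pverts H"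
    "length vs = length ws"
    "unitarily_similar (length vs) (adjacency_matrix G vs) (adjacency_matrix H ws)"
proof -
  obtain vs where vs: "set vs = pverts G" "distinct vs" using finite_distinct_list[OF G(1)] by blast
  obtain ws where ws: "set ws = pverts H" "distinct ws" using finite_distinct_list[OF H(1)] by blast
  let ?A = "adjacency_matrix G vs" and ?B = "adjacency_matrix H ws"
  have A: "?A \<in> carrier_mat (length vs) (length vs)" and B: "?B \<in> carrier_mat (length ws) (length ws)"
    by (simp_all add: adjacency_matrix_def)
  have eq: "char_poly ?A = char_poly ?B"
    using spec degree_monic_char_poly[OF A] degree_monic_char_poly[OF B]
    by (intro proots_eq_imp_eq)
      (simp_all add: adjacency_spectrum_eq[OF vs(2,1)] adjacency_spectrum_eq[OF ws(2,1)])
  then have len: "length vs = length ws"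
    using degree_monic_char_poly[OF A] degree_monic_char_poly[OF B] by simp
  show ?thesis
  proof (rule that[OF vs(2,1) ws(2,1) len])
    show "unitarily_similar (length vs) ?A ?B"
      using A B eq len G H
      by (intro hermitian_cospectral_unitarily_similar) (simp_all add: mat_adjoint_adjacency_matrix)
  qed
qed

lemma index_unitary_conjugate:
  assumes "U \<in> carrier_mat n n" "B \<in> carrier_mat n n" "i < n" "j < n"
  shows "(U * B * mat_adjoint U) $$ (i, j) =
    (\<Sum>k<n. \<Sum>l<n. U $$ (i, k) * B $$ (k, l) * cnj (U $$ (j, l)))"
proof -
  have "(U * B * mat_adjoint U) $$ (i, j) =
    (\<Sum>l<n. (\<Sum>k<n. U $$ (i, k) * B $$ (k, l)) * cnj (U $$ (j, l)))"
    using assms by (auto simp: scalar_prod_def lessThan_atLeast0 intro!: sum.cong)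
  also have "\<dots> = (\<Sum>k<n. \<Sum>l<n. U $$ (i, k) * B $$ (k, l) * cnj (U $$ (j, l)))"
    unfolding sum_distrib_right by (rule sum.swap)
  finally show ?thesis .
qed

lemma sum_distinct_list:
  assumes "distinct vs" "set vs = V"
  shows "(\<Sum>v\<in>V. g v) = (\<Sum>i<length vs. g (vs ! i))"
  using sum.reindex_bij_betw[OF bij_betw_nth[OF assms(1) refl assms(2)[symmetric]], of g] by simp

lemma quad_form_list:
  assumes "distinct vs" "set vs = pverts G"
  shows "quad_form G f = (\<Sum>i<length vs. \<Sum>j<length vs.
    adjacency_matrix G vs $$ (i, j) * (cnj (f (vs ! i)) * f (vs ! j)))"
  unfolding quad_form_def sum_distinct_list[OF assms]
  by (intro sum.cong) (auto simp: adjacency_matrix_def)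

text \<open>From \<open>A = U * B * mat_adjoint U\<close>, the form of \<open>A\<close> at
  \<open>f\<close> is the form of \<open>B\<close> at \<open>mat_adjoint U\<close> applied to
  \<open>f\<close>. The kernel \<open>K\<close> is \<open>mat_adjoint U\<close> with rows and
  columns labelled by vertices of the two graphs.\<close>

lemma cospectral_imp_congruent:
  fixes G :: "'a pair_pre_digraph" and H :: "'b pair_pre_digraph"
  assumes "finite (pverts G)" "sym (parcs G)" "finite (pverts H)" "sym (parcs H)"
    and "adjacency_spectrum G = adjacency_spectrum H"
  obtains K :: "'b \<Rightarrow> 'a \<Rightarrow> complex"
  where "\<And>f. quad_form G f = quad_form H (\<lambda>w. \<Sum>v\<in>pverts G. K w v * f v)"
proof -
  obtain vs ws where vs: "distinct vs" "set vs = pverts G" and ws: "distinct ws" "set ws = pverts H"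
    and len: "length vs = length ws"
    and us: "unitarily_similar (length vs) (adjacency_matrix G vs) (adjacency_matrix H ws)"
    using cospectral_imp_unitarily_similar[OF assms] .
  define n where "n = length vs"
  let ?A = "adjacency_matrix G vs" and ?B = "adjacency_matrix H ws"
  have B: "?B \<in> carrier_mat n n" by (simp add: adjacency_matrix_def n_def len)
  obtain U where U: "U \<in> carrier_mat n n" "?A = U * ?B * mat_adjoint U"
    using us unfolding unitarily_similar_def n_def by blast
  \<comment> \<open>\<open>iv\<close> and \<open>iw\<close> send a vertex to its position in the
    enumeration.\<close>
  define iv where "iv = the_inv_into {..<n} (nth vs)"
  define iw where "iw = the_inv_into {..<n} (nth ws)"
  have iv: "iv (vs ! i) = i" if "i < n" for i
    unfolding iv_def using vs(1) that
    by (intro the_inv_into_f_f) (auto simp: n_def inj_on_def nth_eq_iff_index_eq)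
  have iw: "iw (ws ! i) = i" if "i < n" for i
    unfolding iw_def using ws(1) that len
    by (intro the_inv_into_f_f) (auto simp: n_def inj_on_def nth_eq_iff_index_eq)
  define K where "K w v = cnj (U $$ (iv v, iw w))" for w v
  show ?thesis
  proof (rule that)
    fix f :: "'a \<Rightarrow> complex"
    let ?f = "\<lambda>i. f (vs ! i)"
    have K: "(\<Sum>v\<in>pverts G. K (ws ! k) v * f v) = (\<Sum>i<n. cnj (U $$ (i, k)) * ?f i)" if "k < n" for k
      unfolding sum_distinct_list[OF vs] n_def[symmetric]
      by (intro sum.cong) (use that in \<open>auto simp: K_def iv iw\<close>)
    have "quad_form G f = (\<Sum>i<n. \<Sum>j<n. ?A $$ (i, j) * (cnj (?f i) * ?f j))"
      by (simp add: quad_form_list[OF vs] n_def)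
    also have "\<dots> = (\<Sum>i<n. \<Sum>j<n. \<Sum>k<n. \<Sum>l<n.
        U $$ (i, k) * ?B $$ (k, l) * cnj (U $$ (j, l)) * (cnj (?f i) * ?f j))"
      by (intro sum.cong refl)
        (simp add: U(2) index_unitary_conjugate[OF U(1) B] sum_distrib_right del: index_mult_mat)
    \<comment> \<open>With the matrix indices of \<open>B\<close> outermost, the inner double sum
      over \<open>i\<close> and \<open>j\<close> factors into a product.\<close>
    also have "\<dots> = (\<Sum>k<n. \<Sum>l<n. \<Sum>i<n. \<Sum>j<n.
        U $$ (i, k) * ?B $$ (k, l) * cnj (U $$ (j, l)) * (cnj (?f i) * ?f j))"
      (is "?L = ?R")
    proof -
      let ?t = "\<lambda>i j k l. U $$ (i, k) * ?B $$ (k, l) * cnj (U $$ (j, l)) * (cnj (?f i) * ?f j)"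
      have "?L = (\<Sum>i<n. \<Sum>k<n. \<Sum>j<n. \<Sum>l<n. ?t i j k l)"
        by (rule sum.cong[OF refl]) (rule sum.swap)
      also have "\<dots> = (\<Sum>k<n. \<Sum>i<n. \<Sum>j<n. \<Sum>l<n. ?t i j k l)" by (rule sum.swap)
      also have "\<dots> = (\<Sum>k<n. \<Sum>i<n. \<Sum>l<n. \<Sum>j<n. ?t i j k l)"
        by (rule sum.cong[OF refl], rule sum.cong[OF refl]) (rule sum.swap)
      also have "\<dots> = ?R" by (rule sum.cong[OF refl]) (rule sum.swap)
      finally show ?thesis .
    qed
    also have "\<dots> = (\<Sum>k<n. \<Sum>l<n. ?B $$ (k, l) *
        (cnj (\<Sum>i<n. cnj (U $$ (i, k)) * ?f i) * (\<Sum>j<n. cnj (U $$ (j, l)) * ?f j)))"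
      by (intro sum.cong refl) (simp add: sum_product sum_distrib_left mult_ac)
    also have "\<dots> = quad_form H (\<lambda>w. \<Sum>v\<in>pverts G. K w v * f v)"
      unfolding quad_form_list[OF ws] len[symmetric] n_def[symmetric]
      by (intro sum.cong refl) (simp add: K)
    finally show "quad_form G f = quad_form H (\<lambda>w. \<Sum>v\<in>pverts G. K w v * f v)" .
  qed
qed

section \<open>Numbers of vertices and arcs as spectral invariants\<close>

text \<open>A diagonal entry of the squared adjacency matrix is the degree of its vertex, so the
  trace of the square counts arcs, that is, every edge twice.\<close>

lemma card_parcs_list:
  assumes "distinct vs" "set vs = pverts G" "sym (parcs G)" "parcs G \<subseteq> pverts G \<times> pverts G"
  shows "of_nat (card (parcs G)) = (\<Sum>i<length vs. (adjacency_matrix G vs * adjacency_matrix G vs) $$ (i, i))"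
proof -
  have fin: "finite (pverts G)" using assms(2) by (metis List.finite_set)
  have "of_nat (card (parcs G)) = (\<Sum>(u, v)\<in>pverts G \<times> pverts G. if (u, v) \<in> parcs G then 1 else (0 :: complex))"
    using fin assms(4) by (simp add: case_prod_unfold sum.If_cases Int_absorb1)
  also have "\<dots> = (\<Sum>u\<in>pverts G. \<Sum>v\<in>pverts G. if (u, v) \<in> parcs G then 1 else 0)"
    by (simp add: sum.cartesian_product)
  also have "\<dots> = (\<Sum>i<length vs. \<Sum>j<length vs. if (vs ! i, vs ! j) \<in> parcs G then 1 else 0)"
    unfolding sum_distinct_list[OF assms(1,2)] ..
  also have "\<dots> = (\<Sum>i<length vs. (adjacency_matrix G vs * adjacency_matrix G vs) $$ (i, i))"
    using symD[OF assms(3)]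
    by (intro sum.cong refl)
      (auto simp: adjacency_matrix_def scalar_prod_def lessThan_atLeast0 intro!: sum.cong)
  finally show ?thesis .
qed

lemma trace_mult_commute:
  fixes A B :: "'a :: comm_ring_1 mat"
  assumes "A \<in> carrier_mat n n" "B \<in> carrier_mat n n"
  shows "(\<Sum>i<n. (A * B) $$ (i, i)) = (\<Sum>i<n. (B * A) $$ (i, i))"
proof -
  have "(\<Sum>i<n. (A * B) $$ (i, i)) = (\<Sum>i<n. \<Sum>j<n. A $$ (i, j) * B $$ (j, i))"
    using assms by (auto simp: scalar_prod_def lessThan_atLeast0 intro!: sum.cong)
  also have "\<dots> = (\<Sum>j<n. \<Sum>i<n. B $$ (j, i) * A $$ (i, j))"
    by (subst sum.swap) (simp add: mult.commute)
  also have "\<dots> = (\<Sum>i<n. (B * A) $$ (i, i))"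
    using assms by (auto simp: scalar_prod_def lessThan_atLeast0 intro!: sum.cong)
  finally show ?thesis .
qed

text \<open>The squares of unitarily similar matrices are again conjugate by \<open>U\<close>, and
  cyclic invariance of the trace removes \<open>U\<close>; the trace of the square is the number of
  arcs.\<close>

lemma cospectral_imp_card_eq:
  assumes "finite (pverts G)" "sym (parcs G)" "finite (pverts H)" "sym (parcs H)"
    and "adjacency_spectrum G = adjacency_spectrum H"
    and sub: "parcs G \<subseteq> pverts G \<times> pverts G" "parcs H \<subseteq> pverts H \<times> pverts H"
  shows "card (pverts G) = card (pverts H)" "card (parcs G) = card (parcs H)"
proof -
  obtain vs ws where vs: "distinct vs" "set vs = pverts G" and ws: "distinct ws" "set ws = pverts H"
    and len: "length vs = length ws"
    and us: "unitarily_similar (length vs) (adjacency_matrix G vs) (adjacency_matrix H ws)"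
    using cospectral_imp_unitarily_similar[OF assms(1-5)] .
  show "card (pverts G) = card (pverts H)"
    using vs ws len by (metis distinct_card)
  define n where "n = length vs"
  let ?A = "adjacency_matrix G vs" and ?B = "adjacency_matrix H ws"
  have B: "?B \<in> carrier_mat n n" by (simp add: adjacency_matrix_def n_def len)
  obtain U where U: "U \<in> carrier_mat n n" "?A = U * ?B * mat_adjoint U" "mat_adjoint U * U = 1\<^sub>m n"
    using us unfolding unitarily_similar_def n_def by blast
  note U' = mat_adjoint_carrier[OF U(1)]
  note ass = assoc_mult_mat[of _ n n _ n _ n] mult_carrier_mat[of _ n n _ n]
  have "?A * ?A = U * ?B * (mat_adjoint U * U) * ?B * mat_adjoint U"
    unfolding U(2) using U(1) U' B by (simp add: ass)
  also have "\<dots> = U * (?B * ?B * mat_adjoint U)"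
    unfolding U(3) using U(1) U' B by (simp add: ass)
  finally have AA: "?A * ?A = U * (?B * ?B * mat_adjoint U)" .
  have BB: "?B * ?B * mat_adjoint U * U = ?B * ?B"
    using U(1,3) U' B by (simp add: ass)
  have "of_nat (card (parcs G)) = (\<Sum>i<n. (U * (?B * ?B * mat_adjoint U)) $$ (i, i))"
    using card_parcs_list[OF vs assms(2) sub(1)] AA by (simp add: n_def)
  also have "\<dots> = (\<Sum>i<n. (?B * ?B * mat_adjoint U * U) $$ (i, i))"
    using U(1) U' B by (intro trace_mult_commute) (simp_all add: ass)
  also have "\<dots> = of_nat (card (parcs H))"
    using card_parcs_list[OF ws assms(4) sub(2)] BB by (simp add: n_def len)
  finally have "(of_nat (card (parcs G)) :: complex) = of_nat (card (parcs H))" .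
  then show "card (parcs G) = card (parcs H)" by (simp only: of_nat_eq_iff)
qed

subsection \<open>Complete multipartite graphs and inertia\<close>

text \<open>The arc set from \<open>is_turan_graph\<close>, without the balance condition, so that
  it can also describe the unknown graph.\<close>

definition multipartite_arcs :: "'a set set \<Rightarrow> ('a \<times> 'a) set" where
  "multipartite_arcs P = {(u, v). \<exists>A\<in>P. \<exists>B\<in>P. A \<noteq> B \<and> u \<in> A \<and> v \<in> B}"

lemma sym_multipartite_arcs: "sym (multipartite_arcs P)"
  unfolding multipartite_arcs_def sym_def by blast

lemma multipartite_arcs_subset:
  assumes "partition_on V P"
  shows "multipartite_arcs P \<subseteq> V \<times> V"
  using assms unfolding multipartite_arcs_def partition_on_def by blast

lemma partition_on_unique:
  assumes "partition_on V P" "A \<in> P" "B \<in> P" "u \<in> A" "u \<in> B"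
  shows "A = B"
  using assms unfolding partition_on_def disjoint_def by blast

lemma multipartite_arcs_iff:
  assumes "partition_on V P" "A \<in> P" "B \<in> P" "u \<in> A" "v \<in> B"
  shows "(u, v) \<in> multipartite_arcs P \<longleftrightarrow> A \<noteq> B"
proof
  assume "(u, v) \<in> multipartite_arcs P"
  then obtain A' B' where "A' \<in> P" "B' \<in> P" "A' \<noteq> B'" "u \<in> A'" "v \<in> B'"
    unfolding multipartite_arcs_def by blast
  moreover from this have "A' = A" "B' = B"
    using assms partition_on_unique[OF assms(1)] by metis+
  ultimately show "A \<noteq> B" by simp
qed (use assms in \<open>auto simp: multipartite_arcs_def\<close>)

lemma sum_partition_on:
  assumes "finite V" "partition_on V P"
  shows "(\<Sum>v\<in>V. g v) = (\<Sum>A\<in>P. \<Sum>v\<in>A. g v)"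
proof -
  have "finite A" if "A \<in> P" for A
    using assms that partition_onD1 by (metis Sup_upper finite_subset)
  then show ?thesis
    using sum.Union_disjoint[of P g] assms partition_onD1[OF assms(2)] partition_onD2[OF assms(2)]
    unfolding disjoint_def by simp
qed

lemma cnj_mult_self: "cnj z * z = (complex_of_real (cmod z))\<^sup>2"
  by (simp add: complex_norm_square[symmetric] mult.commute[of "cnj z"] flip: of_real_power)

text \<open>A vertex is adjacent exactly to the vertices outside its part. Hence the form is the sum
  over all pairs minus the sum over pairs within a common part, and each of these double sums is a
  squared modulus.\<close>

lemma quad_form_multipartite:
  assumes V: "finite V" "partition_on V P"
  shows "quad_form \<lparr>pverts = V, parcs = multipartite_arcs P\<rparr> y =
    complex_of_real ((cmod (\<Sum>v\<in>V. y v))\<^sup>2 - (\<Sum>A\<in>P. (cmod (\<Sum>v\<in>A. y v))\<^sup>2))"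
proof -
  have fin: "finite A" "A \<subseteq> V" if "A \<in> P" for A
    using V that partition_onD1 by (metis Sup_upper finite_subset)+
  have eq: "(\<Sum>v\<in>V. if (u, v) \<in> multipartite_arcs P then cnj (y u) * y v else 0) =
    (\<Sum>v\<in>V. cnj (y u) * y v) - (\<Sum>v\<in>A. cnj (y u) * y v)" if A: "A \<in> P" and u: "u \<in> A" for A u
  proof -
    have iff: "(u, v) \<in> multipartite_arcs P \<longleftrightarrow> v \<notin> A" if v: "v \<in> V" for v
    proof -
      obtain B where "B \<in> P" "v \<in> B" using v V partition_onD1 by blast
      then show ?thesis
        using multipartite_arcs_iff[OF V(2) A _ u] partition_on_unique[OF V(2)] A by blast
    qed
    have "(\<Sum>v\<in>V. if (u, v) \<in> multipartite_arcs P then cnj (y u) * y v else 0) =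
      (\<Sum>v\<in>V - A. cnj (y u) * y v)"
      using V(1) by (intro sum.mono_neutral_cong_right) (auto simp: iff)
    then show ?thesis using fin[OF A] V(1) by (simp add: sum_diff)
  qed
  have "quad_form \<lparr>pverts = V, parcs = multipartite_arcs P\<rparr> y =
    (\<Sum>A\<in>P. \<Sum>u\<in>A. \<Sum>v\<in>V. if (u, v) \<in> multipartite_arcs P then cnj (y u) * y v else 0)"
    unfolding quad_form_def by (simp add: sum_partition_on[OF V])
  also have "\<dots> = (\<Sum>A\<in>P. \<Sum>u\<in>A. \<Sum>v\<in>V. cnj (y u) * y v) - (\<Sum>A\<in>P. \<Sum>u\<in>A. \<Sum>v\<in>A. cnj (y u) * y v)"
    by (simp add: eq sum_subtractf)
  also have "(\<Sum>A\<in>P. \<Sum>u\<in>A. \<Sum>v\<in>V. cnj (y u) * y v) = cnj (\<Sum>v\<in>V. y v) * (\<Sum>v\<in>V. y v)"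
    by (simp add: sum_partition_on[OF V, symmetric] sum_product)
  also have "(\<Sum>A\<in>P. \<Sum>u\<in>A. \<Sum>v\<in>A. cnj (y u) * y v) = (\<Sum>A\<in>P. cnj (\<Sum>v\<in>A. y v) * (\<Sum>v\<in>A. y v))"
    by (simp add: sum_product)
  finally show ?thesis by (simp add: cnj_mult_self del: cnj_sum)
qed

lemma quad_form_support:
  assumes "finite (pverts G)" "R \<subseteq> pverts G" "\<And>v. v \<notin> R \<Longrightarrow> f v = 0"
  shows "quad_form G f = (\<Sum>u\<in>R. \<Sum>v\<in>R. if (u, v) \<in> parcs G then cnj (f u) * f v else 0)"
proof -
  have "(\<Sum>v\<in>pverts G. if (u, v) \<in> parcs G then cnj (f u) * f v else 0) =
    (\<Sum>v\<in>R. if (u, v) \<in> parcs G then cnj (f u) * f v else 0)" for u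
    using assms by (intro sum.mono_neutral_right) auto
  then show ?thesis
    unfolding quad_form_def using assms by (simp, intro sum.mono_neutral_right) (auto intro!: sum.neutral)
qed

text \<open>On a clique the adjacency matrix is the all-ones matrix minus the identity.\<close>

lemma quad_form_clique:
  assumes "finite (pverts G)" "R \<subseteq> pverts G" "\<And>v. v \<notin> R \<Longrightarrow> f v = 0"
    and "\<And>u v. u \<in> R \<Longrightarrow> v \<in> R \<Longrightarrow> (u, v) \<in> parcs G \<longleftrightarrow> u \<noteq> v"
  shows "quad_form G f = complex_of_real ((cmod (\<Sum>v\<in>R. f v))\<^sup>2 - (\<Sum>v\<in>R. (cmod (f v))\<^sup>2))"
proof -
  have R: "finite R" using assms finite_subset by blast
  have "quad_form G f = (\<Sum>u\<in>R. \<Sum>v\<in>R. if u \<noteq> v then cnj (f u) * f v else 0)"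
    using assms(4) by (subst quad_form_support[OF assms(1-3)]) (auto intro!: sum.cong)
  also have "\<dots> = (\<Sum>u\<in>R. (\<Sum>v\<in>R. cnj (f u) * f v) - cnj (f u) * f u)"
  proof (rule sum.cong[OF refl])
    fix u assume u: "u \<in> R"
    have "(\<Sum>v\<in>R. if u \<noteq> v then cnj (f u) * f v else 0) = (\<Sum>v\<in>R - {u}. cnj (f u) * f v)"
      using R by (intro sum.mono_neutral_cong_right) auto
    then show "(\<Sum>v\<in>R. if u \<noteq> v then cnj (f u) * f v else 0) =
      (\<Sum>v\<in>R. cnj (f u) * f v) - cnj (f u) * f u"
      using sum.remove[OF R u, of "\<lambda>v. cnj (f u) * f v"] by simp
  qed
  also have "\<dots> = cnj (\<Sum>v\<in>R. f v) * (\<Sum>v\<in>R. f v) - (\<Sum>v\<in>R. cnj (f v) * f v)"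
    by (simp add: sum_subtractf sum_product)
  finally show ?thesis by (simp add: cnj_mult_self del: cnj_sum)
qed

text \<open>Rewrites a coordinate sum of the transformed vector as a linear functional of
  \<open>f\<close> on its support, the shape that \<open>underdetermined_system\<close>
  accepts.\<close>

lemma sum_linear_image:
  fixes f :: "'a \<Rightarrow> complex"
  assumes "finite V" "R \<subseteq> V" "\<And>v. v \<notin> R \<Longrightarrow> f v = 0"
  shows "(\<Sum>w\<in>A. \<Sum>v\<in>V. K w v * f v) = (\<Sum>v\<in>R. (\<Sum>w\<in>A. K w v) * f v)"
proof -
  have "(\<Sum>w\<in>A. \<Sum>v\<in>V. K w v * f v) = (\<Sum>v\<in>V. (\<Sum>w\<in>A. K w v) * f v)"
    by (subst sum.swap) (simp add: sum_distrib_right)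
  also have "\<dots> = (\<Sum>v\<in>R. (\<Sum>w\<in>A. K w v) * f v)"
    using assms by (intro sum.mono_neutral_right) auto
  finally show ?thesis .
qed

text \<open>On a clique, functions with sum zero make the form negative definite; on the
  multipartite side the form is nonnegative wherever all part sums agree. These are
  \<open>card P\<close> linear conditions in total, so a larger clique would carry a nonzero
  function satisfying them all.\<close>

lemma clique_card_le:
  fixes K :: "'b \<Rightarrow> 'a \<Rightarrow> complex"
  assumes G: "finite (pverts G)" and V: "finite V" "partition_on V P" "P \<noteq> {}"
    and K: "\<And>f. quad_form G f =
      quad_form \<lparr>pverts = V, parcs = multipartite_arcs P\<rparr> (\<lambda>w. \<Sum>v\<in>pverts G. K w v * f v)"
    and R: "R \<subseteq> pverts G" "\<And>u v. u \<in> R \<Longrightarrow> v \<in> R \<Longrightarrow> (u, v) \<in> parcs G \<longleftrightarrow> u \<noteq> v"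
  shows "card R \<le> card P"
proof (rule ccontr)
  assume less: "\<not> card R \<le> card P"
  have finR: "finite R" using G R finite_subset by blast
  have finP: "finite P" using V finite_elements by blast
  obtain A0 where A0: "A0 \<in> P" using V by blast
  \<comment> \<open>Coefficients of the condition that the transformed vector has the same sum over
    \<open>A\<close> as over the reference part \<open>A0\<close>.\<close>
  define d where "d A v = (\<Sum>w\<in>A. K w v) - (\<Sum>w\<in>A0. K w v)" for A v
  define F where "F = insert (\<lambda>_. 1) (d ` (P - {A0}))"
  \<comment> \<open>One condition for the sum over the clique and at most one for each part other
    than \<open>A0\<close>.\<close>
  have "card F \<le> Suc (card (d ` (P - {A0})))" unfolding F_def by (rule card_insert_le_m1) auto
  also have "\<dots> \<le> Suc (card (P - {A0}))" using finP by (simp add: card_image_le)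
  also have "\<dots> = card P" using A0 finP by (metis card_Suc_Diff1)
  finally have "card F < card R" using less by simp
  moreover have "finite F" using finP by (simp add: F_def)
  ultimately obtain f where f: "\<exists>r\<in>R. f r \<noteq> 0" "\<And>r. r \<notin> R \<Longrightarrow> f r = 0"
    "\<And>g. g \<in> F \<Longrightarrow> (\<Sum>r\<in>R. g r * f r) = 0"
    using underdetermined_system[of F R] finR by blast
  define y where "y w = (\<Sum>v\<in>pverts G. K w v * f v)" for w
  have sy: "(\<Sum>w\<in>A. y w) = (\<Sum>v\<in>R. (\<Sum>w\<in>A. K w v) * f v)" for A
    unfolding y_def by (rule sum_linear_image[OF G R(1) f(2)])
  define s where "s = (\<Sum>w\<in>A0. y w)"
  have s: "(\<Sum>w\<in>A. y w) = s" if "A \<in> P" for A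
  proof (cases "A = A0")
    case False
    then have "(\<Sum>v\<in>R. d A v * f v) = 0" using f(3) that by (simp add: F_def)
    then show ?thesis by (simp add: s_def sy d_def left_diff_distrib sum_subtractf)
  qed (simp add: s_def)
  have "(\<Sum>w\<in>V. y w) = of_nat (card P) * s"
    unfolding sum_partition_on[OF V(1,2)] by (simp add: s)
  \<comment> \<open>All \<open>card P\<close> part sums equal \<open>s\<close>, so the total is
    \<open>card P * s\<close>.\<close>
  then have "quad_form G f = complex_of_real (((real (card P))\<^sup>2 - real (card P)) * (cmod s)\<^sup>2)"
    unfolding K quad_form_multipartite[OF V(1,2)] y_def[symmetric]
    by (simp add: s norm_mult power_mult_distrib algebra_simps)
  moreover have "(\<Sum>v\<in>R. f v) = 0" using f(3)[of "\<lambda>_. 1"] by (simp add: F_def)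
  then have "quad_form G f = complex_of_real (- (\<Sum>v\<in>R. (cmod (f v))\<^sup>2))"
    by (subst quad_form_clique[OF G R(1) f(2) R(2)]) auto
  ultimately have "((real (card P))\<^sup>2 - real (card P)) * (cmod s)\<^sup>2 = - (\<Sum>v\<in>R. (cmod (f v))\<^sup>2)"
    using of_real_eq_iff by metis
  moreover have "real (card P) \<le> (real (card P))\<^sup>2"
    by (cases "card P") (auto simp: power2_eq_square algebra_simps)
  then have "0 \<le> ((real (card P))\<^sup>2 - real (card P)) * (cmod s)\<^sup>2" by simp
  moreover have "0 < (\<Sum>v\<in>R. (cmod (f v))\<^sup>2)"
    using f(1) finR by (auto intro!: sum_pos2)
  ultimately show False by linarith
qed

text \<open>An edge ab and a vertex c outside it with a neighbour d carry, whatever the adjacency of d to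
  a and b, a two-dimensional space on which the form is positive definite: take equal values at
  a and b, and choose the value at c so that the cross terms cancel.\<close>

lemma adjacent_to_edge:
  fixes K :: "'b \<Rightarrow> 'a \<Rightarrow> complex"
  assumes G: "finite (pverts G)" "sym (parcs G)" "parcs G \<subseteq> pverts G \<times> pverts G"
      "\<And>u. (u, u) \<notin> parcs G"
    and V: "finite V" "partition_on V P"
    and K: "\<And>f. quad_form G f =
      quad_form \<lparr>pverts = V, parcs = multipartite_arcs P\<rparr> (\<lambda>w. \<Sum>v\<in>pverts G. K w v * f v)"
    and ab: "(a, b) \<in> parcs G" and cd: "(c, d) \<in> parcs G"
  shows "(a, c) \<in> parcs G \<or> (b, c) \<in> parcs G"
proof (rule ccontr)
  assume nac: "\<not> ?thesis"
  have s: "(v, u) \<in> parcs G" if "(u, v) \<in> parcs G" for u v using that G(2) by (metis symD)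
  have ns: "(v, u) \<notin> parcs G" if "(u, v) \<notin> parcs G" for u v using that s by blast
  \<comment> \<open>For instance \<open>a = d\<close> would make \<open>c\<close> a neighbour of
    \<open>a\<close>, and \<open>a = c\<close> would make it a neighbour of
    \<open>b\<close>.\<close>
  have dist: "a \<noteq> b" "a \<noteq> c" "b \<noteq> c" "a \<noteq> d" "b \<noteq> d" "c \<noteq> d"
    using ab cd nac G(4) s by blast+
  define R where "R = {a, b, c, d}"
  have finR: "finite R" and cR: "card R = 4" using dist by (auto simp: R_def)
  have RV: "R \<subseteq> pverts G" using ab cd G(3) by (auto simp: R_def)
  \<comment> \<open>\<open>e1\<close> and \<open>e2\<close> record the unknown adjacencies of
    \<open>d\<close>, so that all cases are treated at once.\<close>
  define e1 where "e1 = (if (a, d) \<in> parcs G then 1 else 0 :: complex)"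
  define e2 where "e2 = (if (b, d) \<in> parcs G then 1 else 0 :: complex)"
  \<comment> \<open>Three conditions on four unknowns: \<open>g1\<close> equates the values at
    \<open>a\<close> and \<open>b\<close>, \<open>g2\<close> fixes the value at \<open>c\<close> so
    that the cross terms cancel, and \<open>g3\<close> makes the total of the transformed vector
    zero, where the multipartite form is nonpositive.\<close>
  define g1 where "g1 v = (if v = a then 1 else if v = b then -1 else 0 :: complex)" for v
  define g2 where "g2 v = (if v = a then e1 else if v = b then e2 else if v = c then 1 else -1)" for v
  define g3 where "g3 v = (\<Sum>w\<in>V. K w v)" for v
  have "card {g1, g2, g3} \<le> 3" by (simp add: card_insert_if)
  then have "card {g1, g2, g3} < card R" using cR by simp
  then obtain f where f: "\<exists>r\<in>R. f r \<noteq> 0" "\<And>r. r \<notin> R \<Longrightarrow> f r = 0"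
    "\<And>g. g \<in> {g1, g2, g3} \<Longrightarrow> (\<Sum>r\<in>R. g r * f r) = 0"
    using underdetermined_system[of "{g1, g2, g3}" R] finR by blast
  have "(\<Sum>r\<in>R. g1 r * f r) = f a - f b" using dist by (simp add: R_def g1_def)
  then have fb: "f b = f a" using f(3)[of g1] by simp
  have "(\<Sum>r\<in>R. g2 r * f r) = e1 * f a + e2 * f b + f c - f d"
    using dist by (simp add: R_def g2_def)
  then have fc: "f c = f d - e1 * f a - e2 * f b" using f(3)[of g2] by (simp add: algebra_simps)
  define y where "y w = (\<Sum>v\<in>pverts G. K w v * f v)" for w
  have "(\<Sum>w\<in>V. y w) = (\<Sum>r\<in>R. g3 r * f r)"
    unfolding y_def g3_def by (rule sum_linear_image[OF G(1) RV f(2)])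
  then have "(\<Sum>w\<in>V. y w) = 0" using f(3)[of g3] by simp
  then have "quad_form G f = complex_of_real (- (\<Sum>A\<in>P. (cmod (\<Sum>v\<in>A. y v))\<^sup>2))"
    unfolding K quad_form_multipartite[OF V] y_def[symmetric] by simp
  moreover have "quad_form G f = complex_of_real (2 * (cmod (f a))\<^sup>2 + 2 * (cmod (f d))\<^sup>2)"
  proof -
    have arcs: "(a, b) \<in> parcs G" "(b, a) \<in> parcs G" "(c, d) \<in> parcs G" "(d, c) \<in> parcs G"
      "(a, c) \<notin> parcs G" "(c, a) \<notin> parcs G" "(b, c) \<notin> parcs G" "(c, b) \<notin> parcs G"
      "(d, a) \<in> parcs G \<longleftrightarrow> (a, d) \<in> parcs G" "(d, b) \<in> parcs G \<longleftrightarrow> (b, d) \<in> parcs G"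
      using ab cd nac s by blast+
    have "quad_form G f = cnj (f a) * f b + cnj (f b) * f a + cnj (f c) * f d + cnj (f d) * f c
      + e1 * (cnj (f a) * f d + cnj (f d) * f a) + e2 * (cnj (f b) * f d + cnj (f d) * f b)"
      using dist arcs G(4)
      by (subst quad_form_support[OF G(1) RV f(2)]) (simp_all add: R_def e1_def e2_def)
    \<comment> \<open>The pair \<open>c\<close>, \<open>d\<close> contributes twice the squared
      modulus of \<open>f d\<close> minus \<open>e1 + e2\<close> times the cross terms of
      \<open>a\<close> and \<open>d\<close>; the possible edges from \<open>d\<close> to
      \<open>a\<close> and \<open>b\<close> add exactly these cross terms back.\<close>
    also have "\<dots> = 2 * (f a * cnj (f a)) + 2 * (f d * cnj (f d))"
      unfolding fc fb by (simp add: e1_def e2_def algebra_simps)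
    finally show ?thesis by (simp add: complex_norm_square[symmetric])
  qed
  ultimately have "2 * (cmod (f a))\<^sup>2 + 2 * (cmod (f d))\<^sup>2 = - (\<Sum>A\<in>P. (cmod (\<Sum>v\<in>A. y v))\<^sup>2)"
    using of_real_eq_iff by metis
  moreover have "0 \<le> (\<Sum>A\<in>P. (cmod (\<Sum>v\<in>A. y v))\<^sup>2)" by (intro sum_nonneg) auto
  ultimately have "(cmod (f a))\<^sup>2 + (cmod (f d))\<^sup>2 \<le> 0" by linarith
  then have "f a = 0" "f d = 0" by (simp_all add: sum_power2_le_zero_iff)
  then show False using f(1) fb fc by (auto simp: R_def)
qed

subsection \<open>Extremality of balanced partitions\<close>

text \<open>Non-adjacency of non-isolated vertices is an equivalence relation, whose classes are the
  parts. Isolated vertices stay outside because the assumption \<open>tr\<close> speaks only of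
  vertices \<open>c\<close> with a neighbour.\<close>

lemma non_adjacency_partition:
  assumes "sym (parcs G)" "\<And>u. (u, u) \<notin> parcs G"
    and tr: "\<And>a b c d. (a, b) \<in> parcs G \<Longrightarrow> (c, d) \<in> parcs G \<Longrightarrow> (a, c) \<in> parcs G \<or> (b, c) \<in> parcs G"
  obtains Q where "partition_on (Domain (parcs G)) Q" "parcs G = multipartite_arcs Q"
proof -
  let ?W = "Domain (parcs G)"
  define r where "r = {(u, v). u \<in> ?W \<and> v \<in> ?W \<and> (u, v) \<notin> parcs G}"
  have s: "(v, u) \<in> parcs G" if "(u, v) \<in> parcs G" for u v using that assms(1) by (metis symD)
  have eq: "equiv ?W r"
  proof (rule equivI)
    show "r \<subseteq> ?W \<times> ?W" by (auto simp: r_def)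
    show "refl_on ?W r" using assms(2) by (auto simp: refl_on_def r_def)
    show "sym r" using s by (auto simp: sym_def r_def)
    show "trans r"
    proof (rule transI)
      fix u v w assume uv: "(u, v) \<in> r" and vw: "(v, w) \<in> r"
      \<comment> \<open>If \<open>u\<close> and \<open>w\<close> were adjacent, then
        \<open>v\<close>, having the neighbour \<open>d\<close>, would be adjacent to one of
        them.\<close>
      then obtain d where "(v, d) \<in> parcs G" by (auto simp: r_def)
      with uv vw tr[of u w v d] s show "(u, w) \<in> r" by (auto simp: r_def)
    qed
  qed
  let ?Q = "?W // r"
  have part: "partition_on ?W ?Q" using eq by (rule partition_on_quotient)
  show ?thesis
  proof (rule that[OF part])
    have "(u, v) \<in> parcs G \<longleftrightarrow> (u, v) \<in> multipartite_arcs ?Q" for u v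
    proof (cases "u \<in> ?W \<and> v \<in> ?W")
      case True
      then have cl: "r `` {u} \<in> ?Q" "r `` {v} \<in> ?Q" "u \<in> r `` {u}" "v \<in> r `` {v}"
        using True equiv_class_self[OF eq] by (auto intro: quotientI)
      have "(u, v) \<in> multipartite_arcs ?Q \<longleftrightarrow> r `` {u} \<noteq> r `` {v}"
        by (rule multipartite_arcs_iff[OF part cl])
      also have "\<dots> \<longleftrightarrow> (u, v) \<notin> r" using eq_equiv_class_iff[OF eq, of u v] True by auto
      also have "\<dots> \<longleftrightarrow> (u, v) \<in> parcs G" using True by (auto simp: r_def)
      finally show ?thesis by simp
    next
      case False
      then show ?thesis using s multipartite_arcs_subset[OF part] by blast
    qed
    then show "parcs G = multipartite_arcs ?Q" by auto
  qed
qed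

text \<open>Choosing one vertex from each part yields a clique, which turns the bound on cliques
  into a bound on the number of parts.\<close>

lemma partition_transversal:
  assumes "finite V" "partition_on V Q"
  obtains R where "R \<subseteq> V" "card R = card Q"
    "\<And>u v. u \<in> R \<Longrightarrow> v \<in> R \<Longrightarrow> (u, v) \<in> multipartite_arcs Q \<longleftrightarrow> u \<noteq> v"
proof -
  define c where "c A = (SOME x. x \<in> A)" for A :: "'a set"
  have c: "c A \<in> A" if "A \<in> Q" for A
    using that assms(2) unfolding c_def by (metis partition_onD3 some_in_eq)
  have inj: "inj_on c Q"
    using c partition_on_unique[OF assms(2)] by (metis inj_onI)
  show ?thesis
  proof (rule that[of "c ` Q"])
    show "c ` Q \<subseteq> V" using c partition_onD1[OF assms(2)] by blast
    show "card (c ` Q) = card Q" using inj by (rule card_image)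
    fix u v assume "u \<in> c ` Q" "v \<in> c ` Q"
    then obtain A B where AB: "A \<in> Q" "B \<in> Q" "u = c A" "v = c B" by blast
    then show "(u, v) \<in> multipartite_arcs Q \<longleftrightarrow> u \<noteq> v"
      using multipartite_arcs_iff[OF assms(2), of A B u v] c inj by (auto dest: inj_onD)
  qed
qed

section \<open>Arc counts and part sizes\<close>

lemma card_partition:
  assumes "finite V" "partition_on V P"
  shows "card V = (\<Sum>A\<in>P. card A)"
  using sum_partition_on[OF assms, of "\<lambda>_. 1 :: nat"] by simp

text \<open>The pairs that are not arcs, the diagonal included, form the disjoint union of the
  squares of the parts.\<close>

lemma card_multipartite_arcs:
  assumes V: "finite V" "partition_on V P"
  shows "card (multipartite_arcs P) + (\<Sum>A\<in>P. (card A)\<^sup>2) = (card V)\<^sup>2"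
proof -
  have fin: "finite A" if "A \<in> P" for A
    using V that partition_onD1 by (metis Sup_upper finite_subset)
  have dis: "(A \<times> A) \<inter> (B \<times> B) = {}" if "A \<in> P" "B \<in> P" "A \<noteq> B" for A B
    using that partition_on_unique[OF V(2)] by blast
  have iff: "(u, v) \<in> multipartite_arcs P \<longleftrightarrow> (u, v) \<notin> (\<Union>A\<in>P. A \<times> A)"
    if uv: "u \<in> V" "v \<in> V" for u v
  proof -
    obtain A B where AB: "A \<in> P" "B \<in> P" "u \<in> A" "v \<in> B" using uv partition_onD1[OF V(2)] by blast
    have "(u, v) \<in> (\<Union>A\<in>P. A \<times> A) \<longleftrightarrow> A = B"
    proof
      assume "(u, v) \<in> (\<Union>A\<in>P. A \<times> A)"
      then obtain C where "C \<in> P" "u \<in> C" "v \<in> C" by blast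
      then show "A = B" using AB partition_on_unique[OF V(2)] by metis
    qed (use AB in blast)
    then show ?thesis using multipartite_arcs_iff[OF V(2) AB] by simp
  qed
  have sub: "multipartite_arcs P \<subseteq> V \<times> V" "(\<Union>A\<in>P. A \<times> A) \<subseteq> V \<times> V"
    using multipartite_arcs_subset[OF V(2)] partition_onD1[OF V(2)] by auto
  have un: "V \<times> V = multipartite_arcs P \<union> (\<Union>A\<in>P. A \<times> A)"
    and "multipartite_arcs P \<inter> (\<Union>A\<in>P. A \<times> A) = {}"
    using iff sub by blast+
  moreover have "finite (V \<times> V)" using V by simp
  ultimately have "card (V \<times> V) = card (multipartite_arcs P) + card (\<Union>A\<in>P. A \<times> A)"
    unfolding un by (intro card_Un_disjoint) auto
  also have "card (\<Union>A\<in>P. A \<times> A) = (\<Sum>A\<in>P. card (A \<times> A))"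
    using fin dis finite_elements[OF V] by (intro card_UN_disjoint) auto
  finally show ?thesis by (simp add: card_cartesian_product power2_eq_square)
qed

text \<open>For integers b and q, (b - q) (b - q - 1) is nonnegative, with equality exactly for
  b = q and b = q + 1.\<close>

lemma sum_consecutive_gap:
  fixes b :: "'a \<Rightarrow> int"
  assumes "finite Q"
  shows "(\<Sum>B\<in>Q. (b B)\<^sup>2) \<ge> (2 * q + 1) * (\<Sum>B\<in>Q. b B) - int (card Q) * (q * (q + 1))"
    and "(\<Sum>B\<in>Q. (b B)\<^sup>2) = (2 * q + 1) * (\<Sum>B\<in>Q. b B) - int (card Q) * (q * (q + 1)) \<longleftrightarrow>
      (\<forall>B\<in>Q. b B = q \<or> b B = q + 1)"
proof -
  have eq: "(\<Sum>B\<in>Q. (b B - q) * (b B - q - 1)) =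
    (\<Sum>B\<in>Q. (b B)\<^sup>2) - (2 * q + 1) * (\<Sum>B\<in>Q. b B) + int (card Q) * (q * (q + 1))"
  proof -
    have "(b B - q) * (b B - q - 1) = (b B)\<^sup>2 - (2 * q + 1) * b B + q * (q + 1)" for B
      by (simp add: power2_eq_square algebra_simps)
    then show ?thesis by (simp add: sum.distrib sum_subtractf sum_distrib_left)
  qed
  have nonneg: "0 \<le> (b B - q) * (b B - q - 1)" for B
    by (cases "b B \<le> q") (auto intro: mult_nonneg_nonneg mult_nonpos_nonpos)
  then have "0 \<le> (\<Sum>B\<in>Q. (b B - q) * (b B - q - 1))" by (intro sum_nonneg) auto
  then show "(\<Sum>B\<in>Q. (b B)\<^sup>2) \<ge> (2 * q + 1) * (\<Sum>B\<in>Q. b B) - int (card Q) * (q * (q + 1))"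
    using eq by linarith
  have "(\<Sum>B\<in>Q. (b B - q) * (b B - q - 1)) = 0 \<longleftrightarrow> (\<forall>B\<in>Q. b B = q \<or> b B = q + 1)"
    using assms nonneg by (subst sum_nonneg_eq_0_iff) auto
  then show "(\<Sum>B\<in>Q. (b B)\<^sup>2) = (2 * q + 1) * (\<Sum>B\<in>Q. b B) - int (card Q) * (q * (q + 1)) \<longleftrightarrow>
      (\<forall>B\<in>Q. b B = q \<or> b B = q + 1)"
    using eq by linarith
qed

text \<open>With \<open>m\<close> vertices in \<open>l\<close> parts, the number of arcs is at most
  \<open>m^2 - (2*z + 1)*m + l*z*(z + 1)\<close>, with equality exactly when all part sizes are
  \<open>z\<close> or \<open>z + 1\<close>; the partition \<open>P\<close> attains it. The bound
  increases with \<open>l\<close>, and the larger vertex number \<open>n\<close> gives a strictly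
  larger value than any \<open>m < n\<close> occurring here, so equal arc counts force equality
  everywhere.\<close>

lemma turan_extremal:
  assumes V: "finite V" "partition_on V P" and W: "finite W" "partition_on W Q"
    and q: "1 \<le> q" "\<And>A. A \<in> P \<Longrightarrow> card A = q \<or> card A = q + 1" and k: "2 \<le> card P"
    and le: "card W \<le> card V" "card Q \<le> card P"
    and eq: "card (multipartite_arcs Q) = card (multipartite_arcs P)"
  shows "card W = card V" "card Q = card P" "\<And>B. B \<in> Q \<Longrightarrow> card B = q \<or> card B = q + 1"
proof -
  define n m k l z where "n = int (card V)" "m = int (card W)" "k = int (card P)" "l = int (card Q)" "z = int q"
  note nmkl = this
  have finP: "finite P" and finQ: "finite Q" using V W finite_elements by blast+
  have n: "n = (\<Sum>A\<in>P. int (card A))" and m: "m = (\<Sum>B\<in>Q. int (card B))"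
    by (simp_all add: nmkl card_partition[OF V] card_partition[OF W])
  define e where "e = int (card (multipartite_arcs P))"
  have e1: "e + (\<Sum>A\<in>P. (int (card A))\<^sup>2) = n\<^sup>2"
    using card_multipartite_arcs[OF V] unfolding nmkl e_def by (simp flip: of_nat_power of_nat_sum of_nat_add)
  have e2: "e + (\<Sum>B\<in>Q. (int (card B))\<^sup>2) = m\<^sup>2"
    using card_multipartite_arcs[OF W] eq unfolding nmkl e_def
    by (simp flip: of_nat_power of_nat_sum of_nat_add)
  have "\<forall>A\<in>P. int (card A) = z \<or> int (card A) = z + 1" using q(2) by (force simp: nmkl)
  then have P: "(\<Sum>A\<in>P. (int (card A))\<^sup>2) = (2 * z + 1) * n - k * (z * (z + 1))"
    using sum_consecutive_gap(2)[OF finP, of "\<lambda>A. int (card A)" z] by (simp add: n nmkl(3))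
  have Q: "(2 * z + 1) * m - l * (z * (z + 1)) \<le> (\<Sum>B\<in>Q. (int (card B))\<^sup>2)"
    using sum_consecutive_gap(1)[OF finQ, of z "\<lambda>A. int (card A)"] by (simp add: m nmkl(4))
  have z: "1 \<le> z" and k2: "2 \<le> k" and mn: "m \<le> n" and lk: "l \<le> k" using q(1) k le by (simp_all add: nmkl)
  \<comment> \<open>At least two parts with at least \<open>z\<close> vertices each give
    \<open>n >= 2*z\<close>. Together with \<open>m >= 2\<close>, proved below, this puts
    \<open>n + m\<close> above \<open>2*z + 1\<close>, as the monotonicity in the number of vertices
    requires.\<close>
  have "(\<Sum>A\<in>P. z) \<le> (\<Sum>A\<in>P. int (card A))" using q(2) by (intro sum_mono) (force simp: nmkl)
  then have "k * z \<le> n" by (simp add: n nmkl(3))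
  moreover have "2 * z \<le> k * z" using k2 z by simp
  ultimately have n2: "2 * z \<le> n" by linarith
  have epos: "e > 0"
  proof -
    obtain A B where AB: "A \<in> P" "B \<in> P" "A \<noteq> B"
      using k by (metis card_2_iff' card_le_Suc0_iff_eq finP not_less_eq_eq numeral_2_eq_2)
    moreover have "A \<noteq> {}" "B \<noteq> {}" using AB partition_onD3[OF V(2)] by auto
    ultimately have "multipartite_arcs P \<noteq> {}" unfolding multipartite_arcs_def by blast
    moreover have "finite (multipartite_arcs P)"
      using multipartite_arcs_subset[OF V(2)] V(1) by (meson finite_SigmaI finite_subset)
    ultimately show ?thesis by (simp add: e_def card_gt_0_iff)
  qed
  have m2: "2 \<le> m"
  proof (rule ccontr)
    assume "\<not> 2 \<le> m"
    moreover have "0 \<le> m" by (simp add: nmkl)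
    ultimately have "m = 0 \<or> m = 1" by linarith
    \<comment> \<open>For \<open>m\<close> equal to 0 or 1, \<open>m^2 = m\<close> leaves no room
      for a positive number of arcs.\<close>
    moreover have "m \<le> (\<Sum>B\<in>Q. (int (card B))\<^sup>2)"
      unfolding m by (intro sum_mono) (simp add: power2_eq_square flip: of_nat_mult)
    ultimately show False using e2 epos by auto
  qed
  have "z * (z + 1) > 0" using z by simp
  then have lk': "l * (z * (z + 1)) \<le> k * (z * (z + 1))" using lk by (intro mult_right_mono) auto
  have "n\<^sup>2 - (2 * z + 1) * n + k * (z * (z + 1)) \<le> m\<^sup>2 - (2 * z + 1) * m + l * (z * (z + 1))"
    using e1 e2 P Q by linarith
  then have main: "n\<^sup>2 - (2 * z + 1) * n \<le> m\<^sup>2 - (2 * z + 1) * m - (k * (z * (z + 1)) - l * (z * (z + 1)))"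
    by linarith
  have mn': "m = n"
  proof (rule ccontr)
    assume "m \<noteq> n"
    then have "0 < (n - m) * (n + m - (2 * z + 1))" using mn n2 m2 by (intro mult_pos_pos) auto
    also have "\<dots> = (n\<^sup>2 - (2 * z + 1) * n) - (m\<^sup>2 - (2 * z + 1) * m)"
      by (simp add: power2_eq_square algebra_simps)
    finally show False using main lk' by linarith
  qed
  then have "k * (z * (z + 1)) \<le> l * (z * (z + 1))" using main by simp
  then have "k \<le> l" using \<open>z * (z + 1) > 0\<close> by (rule mult_right_le_imp_le)
  then have kl: "l = k" using lk by simp
  show "card W = card V" "card Q = card P" using mn' kl by (simp_all add: nmkl)
  \<comment> \<open>With \<open>m = n\<close> and \<open>l = k\<close>, equal arc counts give equal
    sums of squares, which is the equality case of the gap estimate.\<close>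
  have "(\<Sum>B\<in>Q. (int (card B))\<^sup>2) = (2 * z + 1) * m - l * (z * (z + 1))"
    using e1 e2 P unfolding mn' kl by linarith
  then have "\<forall>B\<in>Q. int (card B) = z \<or> int (card B) = z + 1"
    using sum_consecutive_gap(2)[OF finQ, of "\<lambda>B. int (card B)" z] by (simp add: m nmkl(4))
  then show "card B = q \<or> card B = q + 1" if "B \<in> Q" for B using that by (force simp: nmkl)
qed

section \<open>Isomorphism of balanced complete multipartite graphs\<close>

text \<open>The number of vertices is \<open>q\<close> times the number of parts plus the number of
  parts of size \<open>q + 1\<close>. So both partitions have equally many large parts and equally
  many small ones, and these are matched separately.\<close>

lemma balanced_partitions_bij:
  assumes V: "finite V" "partition_on V P" and W: "finite W" "partition_on W Q"
    and "card W = card V" "card Q = card P"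
    and P: "\<And>A. A \<in> P \<Longrightarrow> card A = q \<or> card A = q + 1"
    and Q: "\<And>B. B \<in> Q \<Longrightarrow> card B = q \<or> card B = q + 1"
  obtains h where "bij_betw h Q P" "\<And>B. B \<in> Q \<Longrightarrow> card (h B) = card B"
proof -
  have finP: "finite P" and finQ: "finite Q" using V W finite_elements by blast+
  have count: "(\<Sum>A\<in>X. card A) = card X * q + card {A \<in> X. card A = q + 1}"
    if "finite X" "\<And>A. A \<in> X \<Longrightarrow> card A = q \<or> card A = q + 1" for X :: "'x set set"
  proof -
    have "(\<Sum>A\<in>X. card A) = (\<Sum>A\<in>X. q + (if card A = q + 1 then 1 else 0))"
      using that(2) by (intro sum.cong) auto
    also have "\<dots> = card X * q + card {A \<in> X. card A = q + 1}"
      using that(1) by (simp add: sum.distrib sum.If_cases Int_def)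
    finally show ?thesis .
  qed
  let ?P1 = "{A \<in> P. card A = q + 1}" and ?Q1 = "{B \<in> Q. card B = q + 1}"
  have "card ?P1 = card ?Q1"
    using count[OF finP P] count[OF finQ Q] card_partition[OF V] card_partition[OF W] assms(5,6) by simp
  then obtain h1 where h1: "bij_betw h1 ?Q1 ?P1"
    using finite_same_card_bij[of ?Q1 ?P1] finP finQ by auto
  have "card (P - ?P1) = card (Q - ?Q1)"
    using \<open>card ?P1 = card ?Q1\<close> finP finQ assms(6) by (simp add: card_Diff_subset)
  then obtain h2 where h2: "bij_betw h2 (Q - ?Q1) (P - ?P1)"
    using finite_same_card_bij[of "Q - ?Q1" "P - ?P1"] finP finQ by auto
  define h where "h B = (if B \<in> ?Q1 then h1 B else h2 B)" for B
  have "bij_betw h (?Q1 \<union> (Q - ?Q1)) (?P1 \<union> (P - ?P1))"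
    using bij_betw_disjoint_Un[OF h1 h2] unfolding h_def by auto
  moreover have "?Q1 \<union> (Q - ?Q1) = Q" "?P1 \<union> (P - ?P1) = P" by auto
  ultimately have "bij_betw h Q P" by simp
  moreover have "card (h B) = card B" if B: "B \<in> Q" for B
  proof (cases "B \<in> ?Q1")
    case True
    then have "h1 B \<in> ?P1" using h1 by (auto simp: bij_betw_def)
    then show ?thesis using True by (simp add: h_def)
  next
    case False
    then have "h2 B \<in> P - ?P1" using h2 B by (auto simp: bij_betw_def)
    then show ?thesis using False B P Q by (auto simp: h_def)
  qed
  ultimately show ?thesis using that by blast
qed

text \<open>Bijections from each part \<open>B\<close> onto \<open>h B\<close> are glued together.
  Adjacency depends only on whether two vertices share a part, and this is preserved because
  \<open>h\<close> is injective.\<close>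

lemma multipartite_iso:
  assumes V: "finite V" "partition_on V P" and W: "finite W" "partition_on W Q"
    and h: "bij_betw h Q P" "\<And>B. B \<in> Q \<Longrightarrow> card (h B) = card B"
  obtains \<phi> where "bij_betw \<phi> W V"
    "\<And>u v. u \<in> W \<Longrightarrow> v \<in> W \<Longrightarrow> (\<phi> u, \<phi> v) \<in> multipartite_arcs P \<longleftrightarrow> (u, v) \<in> multipartite_arcs Q"
proof -
  have finV: "finite A" if "A \<in> P" for A
    using V that partition_onD1 by (metis Sup_upper finite_subset)
  have finW: "finite B" if "B \<in> Q" for B
    using W that partition_onD1 by (metis Sup_upper finite_subset)
  have hP: "h B \<in> P" if "B \<in> Q" for B using h(1) that by (auto simp: bij_betw_def)
  have "\<exists>g. bij_betw g B (h B)" if "B \<in> Q" for B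
    using finite_same_card_bij finW[OF that] finV[OF hP[OF that]] h(2)[OF that] by metis
  then obtain g where g: "\<And>B. B \<in> Q \<Longrightarrow> bij_betw (g B) B (h B)" by metis
  \<comment> \<open>The part that contains \<open>u\<close>.\<close>
  define c where "c u = (THE B. B \<in> Q \<and> u \<in> B)" for u
  have c: "c u = B" if "B \<in> Q" "u \<in> B" for B u
    unfolding c_def using that by (intro the_equality) (auto dest: partition_on_unique[OF W(2)])
  define \<phi> where "\<phi> u = g (c u) u" for u
  have \<phi>: "bij_betw \<phi> B (h B)" if "B \<in> Q" for B
    using g[OF that] by (rule bij_betw_cong[THEN iffD1, rotated]) (simp add: \<phi>_def c[OF that])
  have "disjoint_family_on h Q"
    unfolding disjoint_family_on_def
    using h(1) hP partition_on_unique[OF V(2)] by (metis bij_betw_imp_inj_on disjoint_iff inj_on_contraD)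
  then have "bij_betw \<phi> (\<Union>B\<in>Q. B) (\<Union>B\<in>Q. h B)"
    using \<phi> by (rule bij_betw_UNION_disjoint)
  moreover have "(\<Union>B\<in>Q. h B) = V" "(\<Union>B\<in>Q. B) = W"
    using h(1) partition_onD1[OF V(2)] partition_onD1[OF W(2)] by (auto simp: bij_betw_def)
  ultimately have "bij_betw \<phi> W V" by simp
  moreover have "(\<phi> u, \<phi> v) \<in> multipartite_arcs P \<longleftrightarrow> (u, v) \<in> multipartite_arcs Q"
    if uv: "u \<in> W" "v \<in> W" for u v
  proof -
    obtain A B where AB: "A \<in> Q" "u \<in> A" "B \<in> Q" "v \<in> B" using uv partition_onD1[OF W(2)] by blast
    have "\<phi> u \<in> h A" "\<phi> v \<in> h B" using \<phi> AB by (auto simp: bij_betw_def)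
    then have "(\<phi> u, \<phi> v) \<in> multipartite_arcs P \<longleftrightarrow> h A \<noteq> h B"
      using multipartite_arcs_iff[OF V(2)] hP AB by blast
    also have "\<dots> \<longleftrightarrow> A \<noteq> B" using h(1) AB by (auto simp: bij_betw_def dest: inj_onD)
    also have "\<dots> \<longleftrightarrow> (u, v) \<in> multipartite_arcs Q" using multipartite_arcs_iff[OF W(2)] AB by blast
    finally show ?thesis .
  qed
  ultimately show ?thesis using that by blast
qed

lemma digraph_isoI:
  assumes "pair_wf_digraph G" "bij_betw \<phi> (pverts G) (pverts H)" "parcs H \<subseteq> pverts H \<times> pverts H"
    and "\<And>u v. u \<in> pverts G \<Longrightarrow> v \<in> pverts G \<Longrightarrow> (\<phi> u, \<phi> v) \<in> parcs H \<longleftrightarrow> (u, v) \<in> parcs G"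
  shows "digraph_iso (with_proj G) (with_proj H)"
proof -
  interpret pair_wf_digraph G by fact
  have sub: "parcs G \<subseteq> pverts G \<times> pverts G" using in_arcsD1 in_arcsD2 by auto
  have inj: "inj_on \<phi> (pverts G)" and img: "\<phi> ` pverts G = pverts H"
    using assms(2) by (auto simp: bij_betw_def)
  \<comment> \<open>Arcs are pairs of vertices, so the arc map is induced by the vertex map; the
    projections as tail and head make the image graph literally \<open>with_proj H\<close>.\<close>
  define f where "f = \<lparr>iso_verts = \<phi>, iso_arcs = map_prod \<phi> \<phi>, iso_head = snd, iso_tail = fst\<rparr>"
  have "inj_on (map_prod \<phi> \<phi>) (parcs G)"
    using map_prod_inj_on[OF inj inj] sub by (rule inj_on_subset)
  then have "pre_digraph.digraph_isomorphism (with_proj G) f"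
    unfolding pre_digraph.digraph_isomorphism_def f_def
    using inj wf_digraph_axioms by simp
  moreover have "map_prod \<phi> \<phi> ` parcs G = parcs H"
  proof (intro equalityI subsetI)
    fix e assume "e \<in> parcs H"
    moreover then obtain u v where "u \<in> pverts G" "v \<in> pverts G" "e = (\<phi> u, \<phi> v)"
      using assms(3) img by blast
    ultimately show "e \<in> map_prod \<phi> \<phi> ` parcs G" using assms(4) by force
  qed (use sub assms(4) in auto)
  then have "with_proj H = app_iso f (with_proj G)"
    by (simp add: app_iso_def f_def img with_proj_def)
  ultimately show ?thesis unfolding digraph_iso_def by blast
qed

text \<open>Take \<open>q\<close> to be the least part size; it is positive because parts are
  nonempty, and by balance no part exceeds it by more than 1.\<close>

lemma balanced_partition_sizes:
  assumes V: "finite V" "partition_on V P" "P \<noteq> {}"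
    and bal: "\<forall>A\<in>P. \<forall>B\<in>P. \<bar>int (card A) - int (card B)\<bar> \<le> 1"
  obtains q where "1 \<le> q" "\<And>A. A \<in> P \<Longrightarrow> card A = q \<or> card A = q + 1"
proof -
  have finP: "finite P" using V finite_elements by blast
  define q where "q = Min (card ` P)"
  have "q \<in> card ` P" unfolding q_def using finP V(3) by (intro Min_in) auto
  then obtain A0 where A0: "A0 \<in> P" "card A0 = q" by auto
  have "finite A0" "A0 \<noteq> {}"
    using V A0 partition_onD1 partition_onD3 by (metis Sup_upper finite_subset)+
  then have "1 \<le> q" using A0 by (metis card_gt_0_iff One_nat_def Suc_leI)
  moreover have "card A = q \<or> card A = q + 1" if "A \<in> P" for A
  proof -
    have "q \<le> card A" unfolding q_def using finP that by simp
    moreover have "\<bar>int (card A) - int (card A0)\<bar> \<le> 1" using bal that A0 by blast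
    ultimately show ?thesis using A0 by linarith
  qed
  ultimately show ?thesis using that by blast
qed

theorem theorem2p4p21:
  fixes T :: "'a pair_pre_digraph" and G :: "'b pair_pre_digraph" and n k :: nat
  assumes "2 \<le> k" and "k \<le> n"
    and "is_turan_graph n k T"
    and "pair_graph G"
    and "adjacency_spectrum G = adjacency_spectrum T"
  shows "digraph_iso (with_proj G) (with_proj T)"
proof -
  interpret pair_graph G by fact
  obtain P where V: "finite (pverts T)" "partition_on (pverts T) P" and k: "card P = k"
    and bal: "\<forall>A\<in>P. \<forall>B\<in>P. \<bar>int (card A) - int (card B)\<bar> \<le> 1"
    and arcsT: "parcs T = multipartite_arcs P"
    using assms(3) unfolding is_turan_graph_def multipartite_arcs_def[symmetric] by metis
  have ne: "P \<noteq> {}" using k assms(1) by auto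
  have T: "T = \<lparr>pverts = pverts T, parcs = multipartite_arcs P\<rparr>"
    by (rule pair_pre_digraph.equality) (simp_all add: arcsT)
  have subT: "parcs T \<subseteq> pverts T \<times> pverts T" and symT: "sym (parcs T)"
    unfolding arcsT using multipartite_arcs_subset[OF V(2)] sym_multipartite_arcs by auto
  have finG: "finite (pverts G)" by (rule pair_finite_verts)
  have subG: "parcs G \<subseteq> pverts G \<times> pverts G" using in_arcsD1 in_arcsD2 by auto
  have symG: "sym (parcs G)" using pair_sym_arcs by (simp add: symmetric_def)
  have loopG: "(u, u) \<notin> parcs G" for u using pair_no_loops by fastforce
  note cards = cospectral_imp_card_eq[OF finG symG V(1) symT assms(5) subG subT]
  obtain K where "\<And>f. quad_form G f = quad_form T (\<lambda>w. \<Sum>v\<in>pverts G. K w v * f v)"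
    using cospectral_imp_congruent[OF finG symG V(1) symT assms(5)] by blast
  then have K: "quad_form G f = quad_form \<lparr>pverts = pverts T, parcs = multipartite_arcs P\<rparr>
      (\<lambda>w. \<Sum>v\<in>pverts G. K w v * f v)" for f
    using T by metis
  \<comment> \<open>\<open>Q\<close> covers only the non-isolated vertices of \<open>G\<close>;
    whether there are others is settled by extremality below.\<close>
  obtain Q where Q: "partition_on (Domain (parcs G)) Q" and arcsG: "parcs G = multipartite_arcs Q"
    using non_adjacency_partition[OF symG loopG] adjacent_to_edge[OF finG symG subG loopG V K] by metis
  have domG: "Domain (parcs G) \<subseteq> pverts G" using subG by auto
  then have finD: "finite (Domain (parcs G))" using finG finite_subset by blast
  obtain R where R: "R \<subseteq> Domain (parcs G)" "card R = card Q"
    "\<And>u v. u \<in> R \<Longrightarrow> v \<in> R \<Longrightarrow> (u, v) \<in> multipartite_arcs Q \<longleftrightarrow> u \<noteq> v"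
    using partition_transversal[OF finD Q] by blast
  have lk: "card Q \<le> card P"
    using clique_card_le[OF finG V ne K, of R] R domG unfolding arcsG by auto
  obtain q where q: "1 \<le> q" "\<And>A. A \<in> P \<Longrightarrow> card A = q \<or> card A = q + 1"
    using balanced_partition_sizes[OF V ne bal] by blast
  have leD: "card (Domain (parcs G)) \<le> card (pverts T)"
    using card_mono[OF finG domG] cards(1) by simp
  have eq: "card (multipartite_arcs Q) = card (multipartite_arcs P)"
    using cards(2) arcsG arcsT by simp
  have k2: "2 \<le> card P" using assms(1) k by simp
  note ext = turan_extremal[OF V finD Q q k2 leD lk eq]
  \<comment> \<open>Extremality gives as many non-isolated vertices as \<open>T\<close> has
    vertices, hence as many as \<open>G\<close> has: no vertex of \<open>G\<close> is
    isolated.\<close>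
  have D: "Domain (parcs G) = pverts G"
    using card_subset_eq[OF finG domG] ext(1) cards(1) by simp
  obtain h where h: "bij_betw h Q P" "\<And>B. B \<in> Q \<Longrightarrow> card (h B) = card B"
    using balanced_partitions_bij[OF V finD Q ext(1,2) q(2) ext(3)] by blast
  obtain \<phi> where "bij_betw \<phi> (pverts G) (pverts T)"
    "\<And>u v. u \<in> pverts G \<Longrightarrow> v \<in> pverts G \<Longrightarrow>
      (\<phi> u, \<phi> v) \<in> multipartite_arcs P \<longleftrightarrow> (u, v) \<in> multipartite_arcs Q"
    using multipartite_iso[OF V finD Q h] unfolding D by metis
  then show ?thesis
    using subT by (intro digraph_isoI[OF pair_wf_digraph_axioms, of \<phi>]) (simp_all add: arcsG arcsT)
qed

end
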